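(* For all positive integers $m$ and $p$: $$W(2p+2m-1,2m)=2(-1)^m\sum_{j=0}^{p-1}\bar\zeta(2p-2-2j)\sum_{n=1}^\infty\frac{T_n(\{1\}_{2m-1})T_n(\{1\}_{2j+1})}{n}(-1)^n,$$ $$W(2p+2m-2,2m)=2(-1)^m\sum_{j=0}^{p-2}\bar\zeta(2p-3-2j)\sum_{n=1}^\infty\frac{T_n(\{1\}_{2m-1})T_n(\{1\}_{2j+1})}{n}(-1)^n+(-1)^m\sum_{n=1}^\infty\frac{T_n(\{1\}_{2m-1})S_n(\{1\}_{2p-2})}{n}(-1)^n,$$ $$W(2p+2m-2,2m-1)=4(-1)^{m-1}\sum_{j=0}^{p-1}\bar\zeta(2p-1-2j)\sum_{n=1}^\infty\frac{T_n(\{1\}_{2m-2})T_n(\{1\}_{2j})}{2n-1}(-1)^n+2(-1)^{m-1}\sum_{n=1}^\infty\frac{T_n(\{1\}_{2m-2})S_n(\{1\}_{2p-1})}{2n-1}(-1)^n,$$ $$W(2p+2m-3,2m-1)=4(-1)^{m-1}\sum_{j=0}^{p-1}\bar\zeta(2p-2-2j)\sum_{n=1}^\infty\frac{T_n(\{1\}_{2m-2})T_n(\{1\}_{2j})}{2n-1}(-1)^n.$$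
   Context: $\{1\}_a$ denotes the sequence of $a$ ones. For positive integers $k_1,\dots,k_r$, $\bar T(k_1,\ldots,k_r):=2^r\sum_{0<n_1<\cdots<n_r}\frac{(-1)^{n_r}}{(2n_1-1)^{k_1}(2n_2-2)^{k_2}\cdots(2n_r-r)^{k_r}}$. $I(k,r)$ is the set of tuples $(k_1,\dots,k_r)$ of positive integers with sum $k$, and $W(k,r):=\sum_{(k_1,\dots,k_r)\in I(k,r)}\bar T(k_1,\dots,k_r)$. $\bar\zeta(s):=\sum_{n\ge1}(-1)^{n-1}n^{-s}$ for $s\ge1$, $\bar\zeta(0):=1/2$. Multiple $T$- and $S$-harmonic sums (for $n\ge1$, $a\ge1$), with $T_n(\emptyset)=S_n(\emptyset)=1$: $T_n(\{1\}_{2a-1})=\sum\frac{2^{2a-1}}{(2n_1-1)(2n_2)(2n_3-1)\cdots(2n_{2a-2})(2n_{2a-1}-1)}$ over $0<n_1\le n_2<n_3\le n_4<\cdots\le n_{2a-2}<n_{2a-1}\le n$; $T_n(\{1\}_{2a})=\sum\frac{2^{2a}}{\prod_{i=1}^a(2n_{2i-1}-1)(2n_{2i})}$ over $0<n_1\le n_2<n_3\le\cdots<n_{2a-1}\le n_{2a}<n$; $S_n(\{1\}_{2a-1})=\sum\frac{2^{2a-1}}{(2n_1)(2n_2-1)(2n_3)\cdots(2n_{2a-2}-1)(2n_{2a-1})}$ over $1\le n_1<n_2\le n_3<\cdots<n_{2a-2}\le n_{2a-1}<n$; $S_n(\{1\}_{2a})=\sum\frac{2^{2a}}{\prod_{i=1}^a(2n_{2i-1})(2n_{2i}-1)}$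 over $1\le n_1<n_2\le n_3<\cdots\le n_{2a-1}<n_{2a}\le n$ (empty sums are $0$). *)

theory Defs
  imports Complex_Main
begin

definition Tbar_partial :: "nat list \<Rightarrow> nat \<Rightarrow> real" where
  "Tbar_partial ks N =
     (\<Sum>ns \<in> {ns. length ns = length ks \<and> sorted_wrt (<) ns \<and> set ns \<subseteq> {1..N}}.
        2 ^ length ks * (-1) ^ (last ns) /
        (\<Prod>i<length ks. (2 * real (ns ! i) - real (i + 1)) ^ (ks ! i)))"

text \<open>\<open>Tbar(k_1,...,k_r)\<close> as the limit of the partial sums over \<open>n_r \<le> N\<close>
  (i.e. the iterated series, summed in the outermost index \<open>n_r\<close>).\<close>
definition Tbar :: "nat list \<Rightarrow> real" where
  "Tbar ks = lim (\<lambda>N. Tbar_partial ks N)"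

definition Iset :: "nat \<Rightarrow> nat \<Rightarrow> nat list set" where
  "Iset k r = {ks. length ks = r \<and> (\<forall>x\<in>set ks. 0 < x) \<and> sum_list ks = k}"

definition W :: "nat \<Rightarrow> nat \<Rightarrow> real" where
  "W k r = (\<Sum>ks \<in> Iset k r. Tbar ks)"

definition zetabar :: "nat \<Rightarrow> real" where
  "zetabar s = (if s = 0 then 1/2 else (\<Sum>n. (-1) ^ n / real (n + 1) ^ s))"

text \<open>Index sets for the multiple T- and S-harmonic sums \<open>T_n({1}_l)\<close>, \<open>S_n({1}_l)\<close>
  (0-based list indices: ns!i is \<open>n_{i+1}\<close>).\<close>
definition Tidx :: "nat \<Rightarrow> nat \<Rightarrow> nat list set" where
  "Tidx l n = {ns. length ns = l \<and>
      (0 < l \<longrightarrow> 0 < ns ! 0) \<and>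
      (\<forall>i. i + 1 < l \<longrightarrow> (if even i then ns ! i \<le> ns ! (i+1) else ns ! i < ns ! (i+1))) \<and>
      (0 < l \<longrightarrow> (if odd l then ns ! (l - 1) \<le> n else ns ! (l - 1) < n))}"

definition Sidx :: "nat \<Rightarrow> nat \<Rightarrow> nat list set" where
  "Sidx l n = {ns. length ns = l \<and>
      (0 < l \<longrightarrow> 0 < ns ! 0) \<and>
      (\<forall>i. i + 1 < l \<longrightarrow> (if even i then ns ! i < ns ! (i+1) else ns ! i \<le> ns ! (i+1))) \<and>
      (0 < l \<longrightarrow> (if odd l then ns ! (l - 1) < n else ns ! (l - 1) \<le> n))}"

definition Tn :: "nat \<Rightarrow> nat \<Rightarrow> real" where
  "Tn n l = (\<Sum>ns \<in> Tidx l n. 2 ^ l /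
      (\<Prod>i<l. if even i then 2 * real (ns ! i) - 1 else 2 * real (ns ! i)))"

definition Sn :: "nat \<Rightarrow> nat \<Rightarrow> real" where
  "Sn n l = (\<Sum>ns \<in> Sidx l n. 2 ^ l /
      (\<Prod>i<l. if even i then 2 * real (ns ! i) else 2 * real (ns ! i) - 1))"

end

theory Submission
  imports Defs "HOL-Analysis.Analysis" "HOL-Real_Asymp.Real_Asymp"
begin

text \<open>Put \<open>q = k - r\<close>. Inserting \<open>t ^ (2 * n\<^sub>r - r)\<close> into the series for \<open>W k r\<close> gives functions of \<open>t\<close>
  obeying a first-order linear system; solving it shows that, up to the sign \<open>(-1) ^ r\<close>, \<open>W k r\<close> is the integral
  over \<open>[0, 1]\<close> of \<open>(- ln t) ^ q / q!\<close> against \<open>- d ((2 * (\<pi> / 4 - arctan t)) ^ r / r!)\<close>. In terms of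
  \<open>u = (1 - t) / (1 + t)\<close> the two factors are \<open>ln ((1 + u) / (1 - u)) ^ q / q!\<close> and \<open>d ((2 * arctan u) ^ r / r!)\<close>.
  The power series of the second factor has the T-harmonic sums as coefficients. The moments
  \<open>J\<^sub>q N\<close> of the first factor satisfy \<open>J\<^sub>q (N + 2) = J\<^sub>q N + 2 / (N + 1) * J\<^bsub>q-1\<^esub> (N + 1)\<close> with
  \<open>J\<^sub>q 0 = 0\<close> and \<open>J\<^sub>q 1 = 2 * zetabar q\<close> for \<open>q \<ge> 1\<close>; the T- and S-harmonic sums obey the same recursion,
  so \<open>J\<^sub>q N\<close> is a combination of them with values of \<open>zetabar\<close> as coefficients.\<close>

section \<open>Abel summation\<close>

text \<open>All four formulas are one identity, \<open>wgen_eq_Hsum\<close>, read for the parities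
  of \<open>r\<close> and \<open>q\<close>. In the expansion of \<open>Jint q (2 * n + r)\<close> a
  value of \<open>zetabar\<close> occurs exactly at the levels \<open>i < q\<close> with
  \<open>r + i\<close> odd, and there \<open>hsum i\<close> is a T-sum. The remaining term
  \<open>hsum q\<close> is an S-sum if \<open>q\<close> and \<open>r\<close> have equal parity;
  otherwise it is a T-sum, and the convention \<open>zetabar 0 = 1/2\<close> makes it the last term
  of the sum. The obstacle is that the series converge in general only conditionally. Abel's
  inequality is therefore used three times: for boundary values of power series, for convergence of
  the alternating series, and for exchanging series and integral, where absolute values taken term
  by term would leave a factor of order \<open>1 / t\<close> near 0 that is not integrable.\<close>

lemma Abel_inequality:
  fixes b y :: "nat \<Rightarrow> real"
  assumes B: "\<And>j. j \<le> n \<Longrightarrow> \<bar>\<Sum>k<j. b k\<bar> \<le> e"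
    and dec: "\<And>k. y (Suc k) \<le> y k" and nonneg: "\<And>k. 0 \<le> y k"
  shows "\<bar>\<Sum>k<n. b k * y k\<bar> \<le> e * y 0"
proof -
  have parts: "(\<Sum>k<n. b k * y k) = (\<Sum>k<n. (\<Sum>i<Suc k. b i) * (y k - y (Suc k))) + (\<Sum>i<n. b i) * y n" for n
    by (induction n) (simp_all add: algebra_simps)
  have "\<bar>\<Sum>k<n. b k * y k\<bar> \<le> (\<Sum>k<n. \<bar>\<Sum>i<Suc k. b i\<bar> * (y k - y (Suc k))) + \<bar>\<Sum>i<n. b i\<bar> * y n"
    unfolding parts
    by (intro order.trans[OF abs_triangle_ineq] add_mono order.trans[OF sum_abs])
       (simp_all add: abs_mult dec nonneg del: sum.lessThan_Suc)
  also have "\<dots> \<le> (\<Sum>k<n. e * (y k - y (Suc k))) + e * y n"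
    by (intro add_mono sum_mono mult_right_mono B) (auto simp: dec nonneg)
  also have "\<dots> = e * y 0"
    by (simp only: sum_distrib_left [symmetric] sum_lessThan_telescope') (simp add: algebra_simps)
  finally show ?thesis .
qed

text \<open>Abel's inequality with \<open>y k = x ^ (k + m)\<close> carries the Cauchy bound for
  blocks of \<open>a\<close> over to every \<open>x\<close> at once, including
  \<open>x = 1\<close>.\<close>

lemma uniformly_convergent_power_series_Icc:
  fixes a :: "nat \<Rightarrow> real"
  assumes "summable a"
  shows "uniformly_convergent_on {0..1} (\<lambda>n x. \<Sum>k<n. a k * x ^ k)"
proof (rule Cauchy_uniformly_convergent, unfold uniformly_Cauchy_on_def, intro allI impI)
  fix e :: real assume "e > 0"
  then obtain N where N: "\<And>m n. m \<ge> N \<Longrightarrow> norm (\<Sum>k=m..<n. a k) < e/2"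
    using assms[unfolded summable_Cauchy] by (meson half_gt_zero)
  have main: "\<bar>(\<Sum>k<n. a k * x ^ k) - (\<Sum>k<m. a k * x ^ k)\<bar> < e"
    if x: "x \<in> {0..1}" and mn: "N \<le> m" "m \<le> n" for x m n
  proof -
    have shift: "(\<Sum>k=m..<m + j. f k) = (\<Sum>k<j. f (k + m))" for f :: "nat \<Rightarrow> real" and j
      using sum.shift_bounds_nat_ivl[of f 0 m j] by (simp add: atLeast0LessThan add.commute)
    have "(\<Sum>k<n. a k * x ^ k) - (\<Sum>k<m. a k * x ^ k) = (\<Sum>k=m..<n. a k * x ^ k)"
      using mn by (simp add: sum_diff_nat_ivl flip: atLeast0LessThan)
    also have "\<dots> = (\<Sum>k<n-m. a (k + m) * x ^ (k + m))"
      using shift[of "\<lambda>k. a k * x ^ k" "n - m"] mn by simp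
    also have "\<bar>\<dots>\<bar> \<le> e/2 * x ^ (0 + m)"
    proof (rule Abel_inequality)
      fix j
      show "\<bar>\<Sum>k<j. a (k + m)\<bar> \<le> e / 2"
        using N[OF mn(1), of "m + j"] by (simp only: shift real_norm_def less_imp_le)
    qed (use x in \<open>auto simp: mult_left_le_one_le\<close>)
    also have "\<dots> \<le> e/2 * 1"
      using x \<open>e > 0\<close> by (intro mult_left_mono) (auto simp: power_le_one)
    finally show ?thesis using \<open>e > 0\<close> by simp
  qed
  show "\<exists>M. \<forall>x\<in>{0..1}. \<forall>m\<ge>M. \<forall>n\<ge>M. dist (\<Sum>k<m. a k * x ^ k) (\<Sum>k<n. a k * x ^ k) < e"
  proof (intro exI[of _ N] ballI allI impI)
    fix x :: real and m n assume "x \<in> {0..1}" "N \<le> m" "N \<le> n"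
    then show "dist (\<Sum>k<m. a k * x ^ k) (\<Sum>k<n. a k * x ^ k) < e"
      using main[of x m n] main[of x n m] by (cases "m \<le> n") (auto simp: dist_real_def abs_minus_commute)
  qed
qed

text \<open>Needed because the fundamental theorem of calculus is applied up to
  \<open>t = 1\<close>, where the generating functions sit on the boundary of their disc of
  convergence.\<close>

theorem Abel_limit_theorem:
  fixes a :: "nat \<Rightarrow> real"
  assumes "summable a"
  shows "continuous_on {0..1} (\<lambda>x. \<Sum>n. a n * x ^ n)"
proof -
  have "uniform_limit {0..1} (\<lambda>n x. \<Sum>k<n. a k * x ^ k) (\<lambda>x. \<Sum>n. a n * x ^ n) sequentially"
    using uniformly_convergent_power_series_Icc[OF assms]
    by (simp add: uniformly_convergent_uniform_limit_iff suminf_eq_lim)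
  then show ?thesis
    by (rule uniform_limit_theorem[rotated]) (auto intro!: always_eventually continuous_intros)
qed

text \<open>The Leibniz test does not apply: \<open>e n\<close> times a growing partial sum need not
  be monotone. Summation by parts against the tails \<open>R\<close> of the alternating series of
  \<open>e\<close> moves the sign into \<open>R\<close>. Since \<open>R n\<close> is bounded by
  \<open>e n\<close>, the new series converges absolutely by \<open>sm\<close>, and the boundary
  term vanishes by \<open>lim\<close>.\<close>

lemma summable_alternating_times_partial_sums:
  fixes b e :: "nat \<Rightarrow> real"
  assumes e_dec: "\<And>n. e (Suc n) \<le> e n" and e_lim: "e \<longlonglongrightarrow> 0"
    and b: "\<And>n. 0 \<le> b n"
    and sm: "summable (\<lambda>n. b n * e n)"
    and lim: "(\<lambda>n. e n * (\<Sum>j\<le>n. b j)) \<longlonglongrightarrow> 0"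
  shows "summable (\<lambda>n. (-1) ^ n * (e n * (\<Sum>j\<le>n. b j)))"
proof -
  have dec: "decseq e" using e_dec by (rule decseq_SucI)
  have e_nonneg: "0 \<le> e n" for n
    using decseq_ge[OF dec e_lim] by simp
  define R where "R j = (\<Sum>n. (-1) ^ (n + j) * e (n + j))" for j
  have sm_e: "summable (\<lambda>n. (-1) ^ n * e n)"
    by (rule summable_Leibniz'(1)[OF e_lim e_nonneg e_dec])
  have sm_j: "summable (\<lambda>n. (-1) ^ (n + j) * e (n + j))" for j
    using sm_e by (simp add: summable_iff_shift[where f = "\<lambda>n. (-1) ^ n * e n"])
  have R_step: "(-1) ^ j * e j = R j - R (Suc j)" for j
    using suminf_split_head[OF sm_j[of j]] by (simp add: R_def)
  have R_le: "\<bar>R j\<bar> \<le> e j" for j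
  proof (rule LIMSEQ_le_const2)
    show "(\<lambda>m. \<bar>\<Sum>n<m. (-1) ^ (n + j) * e (n + j)\<bar>) \<longlonglongrightarrow> \<bar>R j\<bar>"
      unfolding R_def by (intro tendsto_rabs summable_LIMSEQ sm_j)
    have "\<bar>\<Sum>k<i. (-1::real) ^ (k + j)\<bar> \<le> 1" for i
    proof -
      have "(\<Sum>k<i. (-1::real) ^ (k + j)) = (-1) ^ j * (if even i then 0 else 1)"
        by (induction i) (auto simp: power_add)
      then show ?thesis by (auto simp: abs_mult)
    qed
    then have "\<bar>\<Sum>n<m. (-1) ^ (n + j) * e (n + j)\<bar> \<le> 1 * e (0 + j)" for m
      by (intro Abel_inequality) (auto simp: e_dec e_nonneg)
    then show "\<exists>N. \<forall>m\<ge>N. \<bar>\<Sum>n<m. (-1) ^ (n + j) * e (n + j)\<bar> \<le> e j"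
      by auto
  qed
  have parts: "(\<Sum>n<Suc M. (-1) ^ n * (e n * (\<Sum>j\<le>n. b j)))
      = (\<Sum>n<Suc M. R n * b n) - R (Suc M) * (\<Sum>j\<le>M. b j)" for M
  proof (induction M)
    case 0
    have "e 0 = R 0 - R (Suc 0)" using R_step[of 0] by simp
    then show ?case by (simp add: left_diff_distrib)
  next
    case (Suc M)
    have "(-1) ^ Suc M * (e (Suc M) * (\<Sum>j\<le>Suc M. b j)) = (R (Suc M) - R (Suc (Suc M))) * (\<Sum>j\<le>Suc M. b j)"
      using R_step[of "Suc M"] by (simp only: mult.assoc [symmetric])
    then show ?case
      using Suc.IH by (subst sum.lessThan_Suc, subst (2) sum.lessThan_Suc) (simp only: sum.atMost_Suc algebra_simps)
  qed
  have "summable (\<lambda>n. R n * b n)"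
    by (rule summable_comparison_test'[OF sm, of 0])
       (use b R_le in \<open>auto simp: abs_mult mult.commute intro!: mult_mono\<close>)
  then have l1: "(\<lambda>M. \<Sum>n<Suc M. R n * b n) \<longlonglongrightarrow> (\<Sum>n. R n * b n)"
    by (intro LIMSEQ_Suc summable_LIMSEQ)
  have l2: "(\<lambda>M. R (Suc M) * (\<Sum>j\<le>M. b j)) \<longlonglongrightarrow> 0"
  proof (rule tendsto_rabs_zero_cancel, rule tendsto_sandwich[OF _ _ tendsto_const lim])
    have "\<bar>R (Suc M)\<bar> * (\<Sum>j\<le>M. b j) \<le> e M * (\<Sum>j\<le>M. b j)" for M
      using R_le[of "Suc M"] e_dec[of M] by (intro mult_right_mono sum_nonneg b) auto
    then show "\<forall>\<^sub>F M in sequentially. \<bar>R (Suc M) * (\<Sum>j\<le>M. b j)\<bar> \<le> e M * (\<Sum>j\<le>M. b j)"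
      by (auto simp: abs_mult sum_nonneg b intro!: always_eventually)
  qed auto
  have "(\<lambda>M. \<Sum>n<Suc M. (-1) ^ n * (e n * (\<Sum>j\<le>n. b j))) \<longlonglongrightarrow> (\<Sum>n. R n * b n) - 0"
    unfolding parts by (intro tendsto_diff l1 l2)
  then have "(\<lambda>M. \<Sum>n<M. (-1) ^ n * (e n * (\<Sum>j\<le>n. b j))) \<longlonglongrightarrow> (\<Sum>n. R n * b n) - 0"
    by (rule LIMSEQ_imp_Suc)
  then show ?thesis
    unfolding summable_def sums_def by blast
qed

section \<open>Coefficients of the depth-and-weight generating functions\<close>

text \<open>The index list is stored in reverse, and the summation indices are shifted to \<open>m\<^sub>i = n\<^sub>i - i\<close>, so that
  \<open>0 \<le> m\<^sub>1 \<le> m\<^sub>2 \<le> \<dots>\<close> and \<open>2 * n\<^sub>i - i = 2 * m\<^sub>i + i\<close>; the argument \<open>n\<close> is the largest index \<open>m\<^sub>r\<close>.\<close>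
primrec tcoeff :: "nat list \<Rightarrow> nat \<Rightarrow> real" where
  "tcoeff [] n = (if n = 0 then 1 else 0)"
| "tcoeff (k # ks) n = 2 / real (2 * n + length ks + 1) ^ k * (\<Sum>j\<le>n. tcoeff ks j)"

section \<open>Growth and alternating summability of the coefficients\<close>

lemma tcoeff_nonneg: "0 \<le> tcoeff ks n"
  by (induction ks arbitrary: n) (auto intro!: sum_nonneg divide_nonneg_nonneg mult_nonneg_nonneg)

lemma weight_le:
  assumes "0 < k"
  shows "2 / real (2 * n + l + 1) ^ k \<le> 2 / (real n + 1)"
proof -
  have "real n + 1 \<le> real (2 * n + l + 1) ^ 1" by simp
  also have "\<dots> \<le> real (2 * n + l + 1) ^ k"
    using assms by (intro power_increasing) auto
  finally show ?thesis by (intro divide_left_mono) auto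
qed

text \<open>Each entry costs at most one factor \<open>2 * harm (n + 1)\<close>: a positive exponent
  leaves a weight of at most \<open>2 / (j + 1)\<close>, and the inner sums are enlarged to the
  common bound \<open>n\<close>.\<close>

lemma partial_sums_tcoeff_le:
  assumes "\<forall>k\<in>set ks. 0 < k"
  shows "(\<Sum>j\<le>n. tcoeff ks j) \<le> (2 * harm (n + 1)) ^ length ks"
  using assms
proof (induction ks arbitrary: n)
  case (Cons k ks)
  have "tcoeff (k # ks) j \<le> 2 / real (Suc j) * (2 * harm (n + 1)) ^ length ks" if "j \<le> n" for j
  proof -
    have "2 / real (2 * j + length ks + 1) ^ k \<le> 2 / real (Suc j)"
      using weight_le[of k j "length ks"] Cons.prems by (simp add: add.commute)
    moreover have "(\<Sum>i\<le>j. tcoeff ks i) \<le> (2 * harm (n + 1)) ^ length ks"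
    proof -
      have "(\<Sum>i\<le>j. tcoeff ks i) \<le> (\<Sum>i\<le>n. tcoeff ks i)"
        using that by (intro sum_mono2) (auto simp: tcoeff_nonneg)
      also have "\<dots> \<le> (2 * harm (n + 1)) ^ length ks"
        using Cons by simp
      finally show ?thesis .
    qed
    ultimately show ?thesis
      unfolding tcoeff.simps by (intro mult_mono) (auto intro!: sum_nonneg tcoeff_nonneg)
  qed
  then have "(\<Sum>j\<le>n. tcoeff (k # ks) j) \<le> (\<Sum>j\<le>n. 2 / real (Suc j) * (2 * harm (n + 1)) ^ length ks)"
    by (intro sum_mono) auto
  also have "\<dots> = (2 * harm (n + 1)) ^ length (k # ks)"
    by (simp add: sum_distrib_right [symmetric] harm_altdef sum_distrib_left lessThan_Suc_atMost divide_inverse)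
  finally show ?case .
qed simp

lemma harm_Suc_le: "harm (n + 1) \<le> 1 + ln (real n + 1)"
proof -
  have "decseq (\<lambda>n. harm (Suc n) - ln (real (Suc n)))" by (rule decseq_harm_diff_ln)
  then have "harm (Suc n) - ln (real (Suc n)) \<le> harm (Suc 0) - ln (real (Suc 0))"
    by (rule decseqD) simp
  then show ?thesis by (simp add: harm_Suc harm_expand add.commute)
qed

text \<open>The exponent 1/2 allows a weight \<open>1 / (n + 1)\<close> to be split into two equal
  halves, one absorbing the logarithms and one tending to 0; against \<open>1 / (n + 1) ^ 2\<close>
  it leaves the summable power -3/2.\<close>

lemma partial_sums_tcoeff_smallo:
  assumes "\<forall>k\<in>set ks. 0 < k"
  shows "(\<lambda>n. (\<Sum>j\<le>n. tcoeff ks j) / (real n + 1) powr (1/2)) \<longlonglongrightarrow> 0"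
proof (rule tendsto_sandwich[OF _ _ tendsto_const])
  show "(\<lambda>n. (2 + 2 * ln (real n + 1)) ^ length ks / (real n + 1) powr (1/2)) \<longlonglongrightarrow> 0"
    by real_asymp
  have "(\<Sum>j\<le>n. tcoeff ks j) \<le> (2 + 2 * ln (real n + 1)) ^ length ks" for n
  proof -
    have "(\<Sum>j\<le>n. tcoeff ks j) \<le> (2 * harm (n + 1)) ^ length ks"
      by (rule partial_sums_tcoeff_le[OF assms])
    also have "\<dots> \<le> (2 + 2 * ln (real n + 1)) ^ length ks"
      using harm_Suc_le[of n] harm_nonneg[of "n + 1", where 'a = real] by (intro power_mono) auto
    finally show ?thesis .
  qed
  then show "\<forall>\<^sub>F n in sequentially. (\<Sum>j\<le>n. tcoeff ks j) / (real n + 1) powr (1/2)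
      \<le> (2 + 2 * ln (real n + 1)) ^ length ks / (real n + 1) powr (1/2)"
    by (intro always_eventually allI divide_right_mono) auto
qed (auto intro!: always_eventually sum_nonneg divide_nonneg_nonneg tcoeff_nonneg)

text \<open>For nonempty \<open>ks\<close>, \<open>tcoeff ks n\<close> is at most of order
  \<open>1 / n\<close> up to logarithms, so a further \<open>1 / n\<close> gives absolute
  convergence. This supplies the hypothesis \<open>sm\<close> above for lists that are one entry
  longer.\<close>

lemma summable_tcoeff_div:
  assumes "\<forall>k\<in>set ks. 0 < k"
  shows "summable (\<lambda>n. tcoeff ks n * (2 / (real n + 1)))"
proof (cases ks)
  case Nil
  then show ?thesis
    by (intro summable_finite[of "{0}"]) auto
next
  case (Cons k ls)
  have pos: "0 < k" "\<forall>k\<in>set ls. 0 < k" using assms Cons by auto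
  obtain C where C: "\<And>n. \<bar>(\<Sum>j\<le>n. tcoeff ls j) / (real n + 1) powr (1/2)\<bar> \<le> C"
    using convergent_imp_Bseq[OF convergentI[OF partial_sums_tcoeff_smallo[OF pos(2)]]]
    by (auto simp: Bseq_def)
  have S: "(\<Sum>j\<le>n. tcoeff ls j) \<le> C * (real n + 1) powr (1/2)" for n
    using order.trans[OF abs_ge_self C[of n]] by (simp add: divide_le_eq)
  have "summable (\<lambda>n. real (Suc n) powr (-3/2))"
    by (subst summable_Suc_iff) (simp add: summable_real_powr_iff)
  then have sm: "summable (\<lambda>n. 4 * C * real (Suc n) powr (-3/2))"
    by (rule summable_mult)
  show ?thesis
  proof (rule summable_comparison_test'[OF sm, of 0])
    fix n :: nat
    have "tcoeff ks n \<le> 2 / (real n + 1) * (C * (real n + 1) powr (1/2))"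
      unfolding Cons tcoeff.simps
      using S[of n] weight_le[OF pos(1), of n "length ls"] 
      by (intro mult_mono) (auto intro!: sum_nonneg tcoeff_nonneg)
    then have "tcoeff ks n * (2 / (real n + 1)) \<le> 2 / (real n + 1) * (C * (real n + 1) powr (1/2)) * (2 / (real n + 1))"
      by (intro mult_right_mono) auto
    also have "\<dots> = 4 * C * ((real n + 1) powr (1/2) / (real n + 1) powr 2)"
      by (simp add: power2_eq_square)
    also have "\<dots> = 4 * C * real (Suc n) powr (-3/2)"
      by (subst powr_diff [symmetric]) (simp add: add.commute)
    finally show "norm (tcoeff ks n * (2 / (real n + 1))) \<le> 4 * C * real (Suc n) powr (-3/2)"
      using tcoeff_nonneg[of ks n] by simp
  qed
qed

text \<open>The head of the reversed list is the outermost exponent. If it is 1, the series without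
  signs diverges, so the alternation has to be exploited.\<close>

lemma summable_alternating_tcoeff:
  assumes "\<forall>k\<in>set ks. 0 < k"
  shows "summable (\<lambda>n. (-1) ^ n * tcoeff ks n)"
proof (cases ks)
  case Nil
  then show ?thesis
    by (intro summable_finite[of "{0}"]) auto
next
  case (Cons k ls)
  have pos: "0 < k" "\<forall>k\<in>set ls. 0 < k" using assms Cons by auto
  define e where "e n = 2 / real (2 * n + length ls + 1) ^ k" for n
  have e_le: "e n \<le> 2 / (real n + 1)" for n
    unfolding e_def by (rule weight_le[OF pos(1)])
  have e_nonneg: "0 \<le> e n" for n by (simp add: e_def)
  have "summable (\<lambda>n. (-1) ^ n * (e n * (\<Sum>j\<le>n. tcoeff ls j)))"
  proof (rule summable_alternating_times_partial_sums)
    show "e (Suc n) \<le> e n" for n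
      unfolding e_def by (intro divide_left_mono power_mono) auto
    show "e \<longlonglongrightarrow> 0"
      by (rule tendsto_sandwich[of "\<lambda>_. 0" _ _ "\<lambda>n. 2 / (real n + 1)"])
         (auto simp: e_le e_nonneg intro!: always_eventually, real_asymp)
    show "summable (\<lambda>n. tcoeff ls n * e n)"
      by (rule summable_comparison_test'[OF summable_tcoeff_div[OF pos(2)], of 0])
         (use tcoeff_nonneg e_nonneg in \<open>simp only: real_norm_def abs_mult abs_of_nonneg mult_left_mono e_le\<close>)
    show "(\<lambda>n. e n * (\<Sum>j\<le>n. tcoeff ls j)) \<longlonglongrightarrow> 0"
    proof (rule tendsto_sandwich[OF _ _ tendsto_const])
      have "(\<lambda>n. 2 / (real n + 1) powr (1/2) * ((\<Sum>j\<le>n. tcoeff ls j) / (real n + 1) powr (1/2))) \<longlonglongrightarrow> 0 * 0"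
        by (intro tendsto_mult partial_sums_tcoeff_smallo pos(2)) real_asymp
      also have "(\<lambda>n. 2 / (real n + 1) powr (1/2) * ((\<Sum>j\<le>n. tcoeff ls j) / (real n + 1) powr (1/2)))
          = (\<lambda>n. 2 / (real n + 1) * (\<Sum>j\<le>n. tcoeff ls j))"
        by (simp add: powr_add [symmetric])
      finally show "(\<lambda>n. 2 / (real n + 1) * (\<Sum>j\<le>n. tcoeff ls j)) \<longlonglongrightarrow> 0" by simp
      show "\<forall>\<^sub>F n in sequentially. e n * (\<Sum>j\<le>n. tcoeff ls j) \<le> 2 / (real n + 1) * (\<Sum>j\<le>n. tcoeff ls j)"
        by (intro always_eventually allI mult_right_mono e_le sum_nonneg tcoeff_nonneg)
    qed (auto intro!: always_eventually mult_nonneg_nonneg e_nonneg sum_nonneg tcoeff_nonneg)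
  qed (rule tcoeff_nonneg)
  then show ?thesis by (simp add: Cons e_def)
qed

section \<open>Sums over all indices of given depth and weight\<close>

definition wcoeff :: "nat \<Rightarrow> nat \<Rightarrow> nat \<Rightarrow> real" where
  "wcoeff r q n = (\<Sum>ks\<in>Iset (r + q) r. tcoeff ks n)"

lemma finite_Iset: "finite (Iset k r)"
proof (rule finite_subset)
  show "Iset k r \<subseteq> {ks. set ks \<subseteq> {..k} \<and> length ks = r}"
    by (auto simp: Iset_def member_le_sum_list)
qed (rule finite_lists_length_eq, simp)

lemma Iset_eq_empty: "k < r \<Longrightarrow> Iset k r = {}"
proof -
  have "length ks \<le> sum_list ks" if "\<forall>x\<in>set ks. 0 < x" for ks :: "nat list"
    using that by (induction ks) auto
  then show "k < r \<Longrightarrow> Iset k r = {}" by (fastforce simp: Iset_def)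
qed

lemma Iset_Suc:
  "Iset (Suc k) (Suc r) = (#) 1 ` Iset k r \<union> (\<lambda>ks. Suc (hd ks) # tl ks) ` Iset k (Suc r)" (is "?L = ?R")
proof
  show "?L \<subseteq> ?R"
  proof
    fix ks assume "ks \<in> ?L"
    then obtain a ls where ks: "ks = a # ls" "length ls = r" "0 < a" "\<forall>x\<in>set ls. 0 < x" "a + sum_list ls = Suc k"
      by (auto simp: Iset_def length_Suc_conv)
    show "ks \<in> ?R"
    proof (cases "a = 1")
      case True
      then show ?thesis using ks by (auto simp: Iset_def)
    next
      case False
      then have "ks = (\<lambda>ks. Suc (hd ks) # tl ks) ((a - 1) # ls)" "(a - 1) # ls \<in> Iset k (Suc r)"
        using ks by (auto simp: Iset_def)
      then show ?thesis by blast
    qed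
  qed
  show "?R \<subseteq> ?L"
    by (auto simp: Iset_def length_Suc_conv)
qed

lemma wcoeff_0: "wcoeff 0 q n = (if q = 0 \<and> n = 0 then 1 else 0)"
proof -
  have "Iset q 0 = (if q = 0 then {[]} else {})"
    by (auto simp: Iset_def)
  then show ?thesis by (simp add: wcoeff_def)
qed

text \<open>Deleting a head 1 lowers the depth and keeps the excess \<open>q\<close>; decrementing a
  larger head keeps the depth and lowers \<open>q\<close>. Working with the excess instead of the
  weight makes each branch change exactly one parameter.\<close>

lemma wcoeff_Suc:
  "real (2 * n + r + 1) * wcoeff (Suc r) q n
     = (case q of 0 \<Rightarrow> 0 | Suc q' \<Rightarrow> wcoeff (Suc r) q' n) + 2 * (\<Sum>j\<le>n. wcoeff r q j)"
proof -
  let ?f = "\<lambda>ks. Suc (hd ks) # tl ks" and ?c = "real (2 * n + r + 1)"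
  have "wcoeff (Suc r) q n = (\<Sum>ks\<in>(#) 1 ` Iset (r + q) r \<union> ?f ` Iset (r + q) (Suc r). tcoeff ks n)"
    unfolding wcoeff_def by (simp only: Iset_Suc add_Suc)
  also have "\<dots> = (\<Sum>ks\<in>(#) 1 ` Iset (r + q) r. tcoeff ks n) + (\<Sum>ks\<in>?f ` Iset (r + q) (Suc r). tcoeff ks n)"
  proof (rule sum.union_disjoint)
    have "hd ks \<noteq> 0" if "ks \<in> Iset (r + q) (Suc r)" for ks
      using that by (cases ks) (auto simp: Iset_def)
    then show "(#) 1 ` Iset (r + q) r \<inter> ?f ` Iset (r + q) (Suc r) = {}" by fastforce
  qed (simp_all add: finite_Iset)
  also have "(\<Sum>ks\<in>(#) 1 ` Iset (r + q) r. tcoeff ks n) = (\<Sum>ks\<in>Iset (r + q) r. 2 / ?c * (\<Sum>j\<le>n. tcoeff ks j))"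
    by (subst sum.reindex) (simp_all add: Iset_def)
  also have "\<dots> = 2 / ?c * (\<Sum>j\<le>n. wcoeff r q j)"
    unfolding wcoeff_def sum_distrib_left by (rule sum.swap)
  also have "(\<Sum>ks\<in>?f ` Iset (r + q) (Suc r). tcoeff ks n) = (\<Sum>ks\<in>Iset (r + q) (Suc r). tcoeff ks n / ?c)"
  proof (subst sum.reindex)
    show "inj_on ?f (Iset (r + q) (Suc r))"
    proof (rule inj_onI)
      fix ks ls assume "ks \<in> Iset (r + q) (Suc r)" "ls \<in> Iset (r + q) (Suc r)" "?f ks = ?f ls"
      then show "ks = ls" by (cases ks; cases ls) (simp_all add: Iset_def)
    qed
    have "tcoeff (?f ks) n = tcoeff ks n / ?c" if "ks \<in> Iset (r + q) (Suc r)" for ks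
      using that by (cases ks) (simp_all add: Iset_def)
    then show "sum ((\<lambda>ks. tcoeff ks n) \<circ> ?f) (Iset (r + q) (Suc r)) = (\<Sum>ks\<in>Iset (r + q) (Suc r). tcoeff ks n / ?c)"
      by (intro sum.cong) (simp_all only: o_def)
  qed
  \<comment> \<open>For \<open>q = 0\<close> the weight is smaller than the depth, so the index set
    is empty.\<close>
  also have "\<dots> = (case q of 0 \<Rightarrow> 0 | Suc q' \<Rightarrow> wcoeff (Suc r) q' n) / ?c"
    by (simp add: wcoeff_def sum_divide_distrib Iset_eq_empty split: nat.split)
  finally have w: "wcoeff (Suc r) q n = 2 / ?c * (\<Sum>j\<le>n. wcoeff r q j)
      + (case q of 0 \<Rightarrow> 0 | Suc q' \<Rightarrow> wcoeff (Suc r) q' n) / ?c" .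
  have "c * (2 / c * S + K / c) = K + 2 * S" if "c \<noteq> 0" for c S K :: real
    using that by (simp add: field_simps)
  then show ?thesis unfolding w by simp
qed

lemma wcoeff_nonneg: "0 \<le> wcoeff r q n"
  unfolding wcoeff_def by (intro sum_nonneg tcoeff_nonneg)

lemma summable_alternating_wcoeff: "summable (\<lambda>n. (-1) ^ n * wcoeff r q n)"
  unfolding wcoeff_def sum_distrib_left
  by (intro summable_sum summable_alternating_tcoeff) (simp add: Iset_def)

section \<open>Generating functions and their differential equations\<close>

definition wgen :: "nat \<Rightarrow> nat \<Rightarrow> real \<Rightarrow> real" where
  "wgen r q x = (\<Sum>n. wcoeff r q n * x ^ n)"

lemma summable_wcoeff_power:
  fixes x :: real
  assumes "\<bar>x\<bar> < 1"
  shows "summable (\<lambda>n. wcoeff r q n * x ^ n)"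
proof (rule powser_inside)
  show "summable (\<lambda>n. wcoeff r q n * (-1) ^ n)"
    using summable_alternating_wcoeff[of r q] by (simp add: mult.commute)
qed (use assms in simp)

lemma wgen_0: "wgen 0 q x = (if q = 0 then 1 else 0)"
proof -
  have "(\<lambda>n. wcoeff 0 q n * x ^ n) sums (\<Sum>n\<in>{0}. wcoeff 0 q n * x ^ n)"
    by (rule sums_finite) (auto simp: wcoeff_0)
  then show ?thesis
    unfolding wgen_def by (simp add: sums_iff wcoeff_0)
qed

lemma sums_partial_sums_wcoeff_power:
  fixes x :: real
  assumes x: "\<bar>x\<bar> < 1"
  shows "(\<lambda>n. (\<Sum>j\<le>n. wcoeff r q j) * x ^ n) sums (wgen r q x / (1 - x))"
proof -
  have "summable (\<lambda>n. norm (wcoeff r q n * x ^ n))"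
  proof (rule powser_insidea)
    show "summable (\<lambda>n. wcoeff r q n * (-1) ^ n)"
      using summable_alternating_wcoeff[of r q] by (simp add: mult.commute)
  qed (use x in simp)
  moreover have "summable (\<lambda>n. norm (x ^ n))"
    unfolding norm_power by (rule summable_geometric) (use x in simp)
  ultimately have "(\<lambda>n. \<Sum>j\<le>n. wcoeff r q j * x ^ j * x ^ (n - j)) sums (wgen r q x * (\<Sum>n. x ^ n))"
    unfolding wgen_def by (rule Cauchy_product_sums)
  then show ?thesis
    using x by (simp add: suminf_geometric sum_distrib_right mult.assoc flip: power_add)
qed

text \<open>This is \<open>wcoeff_Suc\<close> read on power series: \<open>2 * x * D\<close>
  multiplies the coefficients by \<open>2 * n\<close>, and division by \<open>1 - x\<close> forms
  partial sums.\<close>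

lemma wgen_ODE:
  assumes x: "\<bar>x\<bar> < 1"
  obtains D where "(wgen (Suc r) q has_real_derivative D) (at x)"
    "2 * x * D + real (Suc r) * wgen (Suc r) q x
       = (case q of 0 \<Rightarrow> 0 | Suc q' \<Rightarrow> wgen (Suc r) q' x) + 2 / (1 - x) * wgen r q x"
proof -
  let ?c = "wcoeff (Suc r) q"
  define D where "D = (\<Sum>n. diffs ?c n * x ^ n)"
  have deriv: "(wgen (Suc r) q has_real_derivative D) (at x)"
    unfolding wgen_def D_def
    by (rule termdiffs_strong'[of 1]) (use x in \<open>auto intro: summable_wcoeff_power\<close>)
  have "summable (\<lambda>n. diffs ?c n * x ^ n)"
    by (rule termdiff_converges[of x 1]) (use x in \<open>auto intro: summable_wcoeff_power\<close>)
  \<comment> \<open>\<open>diffs_equiv\<close> produces the exponent \<open>n - 1\<close>; its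
    truncation at \<open>n = 0\<close> is hidden by the factor \<open>n\<close>.\<close>
  from sums_mult[OF diffs_equiv[OF this], of x]
  have xD: "(\<lambda>n. real n * ?c n * x ^ n) sums (x * D)"
    unfolding D_def
    by (rule sums_cong[THEN iffD1, rotated]) (case_tac n; simp)
  have G: "(\<lambda>n. wcoeff r q n * x ^ n) sums wgen r q x" for r q
    unfolding wgen_def by (intro summable_sums summable_wcoeff_power x)
  have K: "(\<lambda>n. (case q of 0 \<Rightarrow> 0 | Suc q' \<Rightarrow> wcoeff (Suc r) q' n) * x ^ n)
      sums (case q of 0 \<Rightarrow> 0 | Suc q' \<Rightarrow> wgen (Suc r) q' x)"
    using G by (cases q) auto
  have "(\<lambda>n. 2 * (real n * ?c n * x ^ n) + real (Suc r) * (?c n * x ^ n))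
      sums (2 * (x * D) + real (Suc r) * wgen (Suc r) q x)"
    by (intro sums_add sums_mult xD G)
  moreover have "2 * (real n * ?c n * x ^ n) + real (Suc r) * (?c n * x ^ n)
      = (case q of 0 \<Rightarrow> 0 | Suc q' \<Rightarrow> wcoeff (Suc r) q' n) * x ^ n + 2 * ((\<Sum>j\<le>n. wcoeff r q j) * x ^ n)" for n
  proof -
    have "2 * (real n * ?c n * x ^ n) + real (Suc r) * (?c n * x ^ n) = (real (2 * n + r + 1) * ?c n) * x ^ n"
      by (simp add: algebra_simps)
    then show ?thesis
      unfolding wcoeff_Suc by (simp add: algebra_simps)
  qed
  ultimately have "2 * (x * D) + real (Suc r) * wgen (Suc r) q x
      = (case q of 0 \<Rightarrow> 0 | Suc q' \<Rightarrow> wgen (Suc r) q' x) + 2 * (wgen r q x / (1 - x))"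
    using sums_add[OF K sums_mult[OF sums_partial_sums_wcoeff_power[OF x, of r q], of 2]]
    by (simp only: sums_unique2)
  then have "2 * x * D + real (Suc r) * wgen (Suc r) q x
       = (case q of 0 \<Rightarrow> 0 | Suc q' \<Rightarrow> wgen (Suc r) q' x) + 2 / (1 - x) * wgen r q x"
    by simp
  with deriv show ?thesis by (rule that)
qed

lemma continuous_on_wgen_neg: "continuous_on {0..1} (\<lambda>x. wgen r q (- x))"
proof -
  have "wgen r q (- x) = (\<Sum>n. ((-1) ^ n * wcoeff r q n) * x ^ n)" for x
    unfolding wgen_def by (rule suminf_cong) (subst power_minus, simp)
  then show ?thesis
    using Abel_limit_theorem[OF summable_alternating_wcoeff[of r q]] by simp
qed

text \<open>For \<open>s = -1\<close> this is, up to the sign \<open>(-1) ^ r\<close>, the sum over all indices of depth \<open>r\<close> and weight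
  \<open>r + q\<close> of the one-variable function obtained from the series for \<open>Tbar\<close> by inserting \<open>t ^ (2 * n\<^sub>r - r)\<close>.\<close>
definition wfun :: "real \<Rightarrow> nat \<Rightarrow> nat \<Rightarrow> real \<Rightarrow> real" where
  "wfun s r q t = t ^ r * wgen r q (s * t\<^sup>2)"

lemma wfun_0: "wfun s 0 q t = (if q = 0 then 1 else 0)"
  by (simp add: wfun_def wgen_0)

text \<open>The power of \<open>t\<close> in \<open>wfun\<close>, with the argument
  \<open>s * t^2\<close>, is the integrating factor that absorbs the term
  \<open>real (Suc r) * wgen (Suc r) q x\<close>. What remains is a system of iterated integrals of
  \<open>dt / t\<close> and \<open>2 * dt / (1 - s * t^2)\<close>.\<close>

lemma wfun_deriv:
  assumes t: "0 < t" "t < 1" and s: "\<bar>s\<bar> = 1"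
  shows "(wfun s (Suc r) q has_real_derivative
     (case q of 0 \<Rightarrow> 0 | Suc q' \<Rightarrow> wfun s (Suc r) q' t / t) + 2 / (1 - s * t\<^sup>2) * wfun s r q t) (at t)"
proof -
  define x where "x = s * t\<^sup>2"
  have "\<bar>x\<bar> < 1"
    using t s by (simp add: x_def abs_mult power_less_one_iff)
  then obtain D where D: "(wgen (Suc r) q has_real_derivative D) (at x)"
    and ODE: "2 * x * D + real (Suc r) * wgen (Suc r) q x
       = (case q of 0 \<Rightarrow> 0 | Suc q' \<Rightarrow> wgen (Suc r) q' x) + 2 / (1 - x) * wgen r q x"
    by (rule wgen_ODE)
  have inner: "((\<lambda>t. s * t\<^sup>2) has_real_derivative (2 * s * t)) (at t)"
    by (auto intro!: derivative_eq_intros)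
  have "((\<lambda>t. wgen (Suc r) q (s * t\<^sup>2)) has_real_derivative (D * (2 * s * t))) (at t)"
    using DERIV_chain2[OF D[unfolded x_def] inner] .
  from DERIV_mult[OF DERIV_pow[of "Suc r" t] this]
  have "(wfun s (Suc r) q has_real_derivative
      (real (Suc r) * t ^ r * wgen (Suc r) q x + t ^ Suc r * (D * (2 * s * t)))) (at t)"
    by (simp add: wfun_def [abs_def] x_def mult.commute)
  also have "real (Suc r) * t ^ r * wgen (Suc r) q x + t ^ Suc r * (D * (2 * s * t))
      = t ^ r * (2 * x * D + real (Suc r) * wgen (Suc r) q x)"
    by (simp add: x_def algebra_simps power2_eq_square)
  also have "\<dots> = (case q of 0 \<Rightarrow> 0 | Suc q' \<Rightarrow> wfun s (Suc r) q' t / t) + 2 / (1 - s * t\<^sup>2) * wfun s r q t"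
    unfolding ODE using t by (simp add: wfun_def x_def distrib_left split: nat.split)
  finally show ?thesis .
qed

lemma continuous_on_wfun:
  assumes s: "\<bar>s\<bar> = 1"
  shows "continuous_on {0..<1} (wfun s r q)"
proof -
  have "continuous_on {-1<..<1} (wgen r q)"
  proof (cases r)
    case 0
    then show ?thesis by (simp add: wgen_0 [abs_def])
  next
    case (Suc r')
    have "isCont (wgen r q) x" if "x \<in> {-1<..<1}" for x
      using that wgen_ODE[of x r' q] Suc by (metis DERIV_isCont abs_less_iff greaterThanLessThan_iff minus_less_iff)
    then show ?thesis by (simp add: continuous_at_imp_continuous_on)
  qed
  then have "continuous_on {0..<1} (\<lambda>t. wgen r q (s * t\<^sup>2))"
  proof (rule continuous_on_compose2)
    show "(\<lambda>t. s * t\<^sup>2) ` {0..<1} \<subseteq> {-1<..<1}"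
    proof clarify
      fix t :: real assume "t \<in> {0..<1}"
      then have "\<bar>s * t\<^sup>2\<bar> < 1" using s by (simp add: abs_mult power_less_one_iff)
      then show "s * t\<^sup>2 \<in> {-1<..<1}" by (simp add: abs_less_iff)
    qed
  qed (intro continuous_intros)
  then show ?thesis unfolding wfun_def by (intro continuous_intros)
qed

text \<open>For \<open>q = 0\<close> the \<open>dt / t\<close> part is absent, so each level
  integrates the previous one against the derivative of \<open>L\<close>; this builds up divided
  powers of \<open>L\<close>.\<close>

lemma wfun_eq_power:
  assumes s: "\<bar>s\<bar> = 1" and L0: "L 0 = 0" and L_cont: "continuous_on {0..<1} L"
    and L: "\<And>t. 0 < t \<Longrightarrow> t < 1 \<Longrightarrow> (L has_real_derivative (2 / (1 - s * t\<^sup>2))) (at t)"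
    and t: "0 \<le> t" "t < 1"
  shows "wfun s r 0 t = L t ^ r / fact r"
  using t
proof (induction r arbitrary: t)
  case 0
  then show ?case by (simp add: wfun_0)
next
  case (Suc r)
  define f where "f t = wfun s (Suc r) 0 t - L t ^ Suc r / fact (Suc r)" for t
  have f0: "f 0 = 0" by (simp add: f_def L0 wfun_def)
  show ?case
  proof (cases "t = 0")
    case False
    have "f t = f 0"
    proof (rule DERIV_isconst2[of 0 t])
      show "0 < t" using False Suc.prems by simp
      have "continuous_on {0..<1} f"
        unfolding f_def by (intro continuous_intros continuous_on_wfun s L_cont) auto
      then show "continuous_on {0..t} f"
        by (rule continuous_on_subset) (use Suc.prems in auto)
      show "(f has_real_derivative 0) (at x)" if x: "0 < x" "x < t" for x
      proof -
        have d: "x < 1" using x Suc.prems by simp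
        from DERIV_cdivide[OF DERIV_power[OF L[OF x(1) d], of "Suc r"], of "fact (Suc r)"]
        have "((\<lambda>t. L t ^ Suc r / fact (Suc r)) has_real_derivative
            (real (Suc r) * L x ^ r * (2 / (1 - s * x\<^sup>2)) / fact (Suc r))) (at x)"
          by (simp add: ac_simps del: power_Suc fact_Suc)
        also have "real (Suc r) * L x ^ r * (2 / (1 - s * x\<^sup>2)) / fact (Suc r) = 2 / (1 - s * x\<^sup>2) * wfun s r 0 x"
          using x d by (simp add: Suc.IH divide_simps)
        finally show ?thesis
          using DERIV_diff[OF wfun_deriv[OF x(1) d s, of r 0]] by (fastforce simp: f_def [abs_def])
      qed
    qed (use Suc.prems in auto)
    then show ?thesis using f0 by (simp add: f_def)
  qed (use f0 in \<open>simp add: f_def\<close>)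
qed

lemma wfun_arctan:
  assumes "0 \<le> t" "t < 1"
  shows "wfun (-1) r 0 t = (2 * arctan t) ^ r / fact r"
  using assms
  by (intro wfun_eq_power) (auto intro!: derivative_eq_intros continuous_intros simp: inverse_eq_divide)

text \<open>The case \<open>s = 1\<close> sums the series without signs and later makes the
  integrable majorant explicit.\<close>

lemma wfun_ln:
  assumes "0 \<le> t" "t < 1"
  shows "wfun 1 r 0 t = ln ((1 + t) / (1 - t)) ^ r / fact r"
proof (intro wfun_eq_power)
  show "continuous_on {0..<1} (\<lambda>t. ln ((1 + t) / (1 - t)) :: real)"
    by (intro continuous_intros) auto
  show "((\<lambda>t. ln ((1 + t) / (1 - t))) has_real_derivative (2 / (1 - 1 * t\<^sup>2))) (at t)"
    if "0 < t" "t < 1" for t :: real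
  proof -
    have "(1 - t) + (1 + t) = 2" "1 - t\<^sup>2 = (1 - t) * (1 + t)" "1 - t \<noteq> 0" "1 + t \<noteq> 0"
      using that by (simp_all add: power2_eq_square algebra_simps)
    then show ?thesis
      using that by (auto intro!: derivative_eq_intros simp: divide_simps power2_eq_square)
  qed
qed (use assms in auto)

section \<open>Logarithmic moments\<close>

definition ell :: "nat \<Rightarrow> real \<Rightarrow> real" where
  "ell k t = (- ln t) ^ k / fact k"

lemma ell_0 [simp]: "ell 0 t = 1"
  by (simp add: ell_def)

lemma ell_1: "ell k 1 = (if k = 0 then 1 else 0)"
  by (simp add: ell_def)

text \<open>This rests on the default \<open>ln 0 = 0\<close>: the logarithmic singularity receives
  the value 0, which settles pointwise claims at \<open>t = 0\<close>.\<close>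

lemma ell_Suc_at_0: "ell (Suc k) 0 = 0"
  by (simp add: ell_def)

lemma ell_nonneg: "t \<le> 1 \<Longrightarrow> 0 \<le> t \<Longrightarrow> 0 \<le> ell k t"
  by (cases "t = 0") (auto simp: ell_def)

lemma ell_deriv:
  assumes "0 < t"
  shows "(ell k has_real_derivative (case k of 0 \<Rightarrow> 0 | Suc k' \<Rightarrow> - ell k' t / t)) (at t)"
proof (cases k)
  case (Suc k')
  have "((\<lambda>t. - ln t) has_real_derivative (- 1 / t)) (at t)"
    using assms by (auto intro!: derivative_eq_intros)
  from DERIV_cdivide[OF DERIV_power[OF this, of "Suc k'"], of "fact (Suc k')"]
  show ?thesis
    using Suc assms by (simp add: ell_def [abs_def] divide_simps mult.commute del: power_Suc)
qed (simp add: ell_def [abs_def])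

text \<open>A factor \<open>t\<close> beats every power of the logarithm. The antiderivatives below
  are arranged so that each \<open>ell\<close> in them comes with such a factor.\<close>

lemma continuous_on_times_ell: "continuous_on {0..1} (\<lambda>t. t * ell k t)"
proof -
  have "continuous (at t within {0..1}) (\<lambda>t. t * ell k t)" if t: "t \<in> {0..1}" for t
  proof (cases "t = 0")
    case True
    have "((\<lambda>t::real. t * ((- ln t) ^ k / fact k)) \<longlongrightarrow> 0) (at_right 0)"
      by real_asymp
    then show ?thesis
      using True by (simp add: continuous_within ell_def at_within_Icc_at_right)
  next
    case False
    then have "isCont (\<lambda>t. t * ell k t) t"
      using t by (intro continuous_intros DERIV_isCont[OF ell_deriv]) auto
    then show ?thesis by (rule continuous_at_imp_continuous_at_within)
  qed
  then show ?thesis by (simp add: continuous_on_eq_continuous_within)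
qed

lemma has_integral_power_times_ell:
  "((\<lambda>t. t ^ n * ell q t) has_integral 1 / real (n + 1) ^ (q + 1)) {0..1}"
proof -
  \<comment> \<open>The outcome of repeated integration by parts: each step divides by
    \<open>n + 1\<close> and lowers the index of \<open>ell\<close>. At 1 only \<open>i = 0\<close>
    survives.\<close>
  define F where "F q t = (\<Sum>i\<le>q. t ^ n * (t * ell i t) / real (n + 1) ^ (q + 1 - i))" for q t
  have deriv: "(F q has_real_derivative t ^ n * ell q t) (at t)" if t: "0 < t" for t
  proof (induction q)
    case 0
    have "((\<lambda>t. t ^ Suc n / real (Suc n)) has_real_derivative t ^ n) (at t)"
      using DERIV_cdivide[OF DERIV_pow[of "Suc n" t], of "real (Suc n)"] by simp
    then show ?case by (simp add: F_def [abs_def] mult.commute)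
  next
    case (Suc q)
    have F_Suc: "F (Suc q) t = F q t / real (n + 1) + t ^ Suc n * ell (Suc q) t / real (n + 1)" for t
      unfolding F_def sum_divide_distrib by (simp add: Suc_diff_le ac_simps)
    have "((\<lambda>t. F q t / real (n + 1) + t ^ Suc n * ell (Suc q) t / real (n + 1)) has_real_derivative
        (t ^ n * ell q t / real (n + 1) +
          (real (Suc n) * t ^ n * ell (Suc q) t + (- ell q t / t) * t ^ Suc n) / real (n + 1))) (at t)"
      using DERIV_mult[OF DERIV_pow[of "Suc n" t] ell_deriv[OF t, of "Suc q"]]
      by (intro DERIV_add DERIV_cdivide Suc.IH) simp
    also have "t ^ n * ell q t / real (n + 1) +
          (real (Suc n) * t ^ n * ell (Suc q) t + (- ell q t / t) * t ^ Suc n) / real (n + 1) = t ^ n * ell (Suc q) t"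
    proof -
      have "(- ell q t / t) * t ^ Suc n = - (t ^ n * ell q t)" using t by simp
      then show ?thesis
        by (simp only: Suc_eq_plus1 [symmetric]) (simp add: diff_divide_distrib del: of_nat_Suc power_Suc)
    qed
    finally show ?case unfolding F_Suc [abs_def] .
  qed
  have "((\<lambda>t. t ^ n * ell q t) has_integral (F q 1 - F q 0)) {0..1}"
  proof (rule fundamental_theorem_of_calculus_interior)
    show "continuous_on {0..1} (F q)"
      unfolding F_def by (intro continuous_intros continuous_on_times_ell) auto
  qed (use deriv in \<open>auto simp flip: has_real_derivative_iff_has_vector_derivative\<close>)
  moreover have "F q 1 = 1 / real (n + 1) ^ (q + 1)"
  proof -
    have "F q 1 = (\<Sum>i\<le>q. if i = 0 then 1 / real (n + 1) ^ (q + 1) else 0)"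
      unfolding F_def by (intro sum.cong) (auto simp: ell_1)
    then show ?thesis by simp
  qed
  moreover have "F q 0 = 0" by (simp add: F_def)
  ultimately show ?thesis by simp
qed

text \<open>For \<open>q > 0\<close>, \<open>ell q\<close> is unbounded near 0, so continuity cannot
  give integrability. Being nonnegative and integrable it is absolutely integrable, and a bounded
  measurable factor preserves this.\<close>

lemma integrable_ell_times:
  assumes "continuous_on {0..1} g"
  shows "(\<lambda>t. ell q t * g t) integrable_on {0..1}"
proof -
  have "ell q integrable_on {0..1}"
    using has_integral_power_times_ell[of 0 q] by auto
  then have "ell q absolutely_integrable_on {0..1}"
    by (intro nonnegative_absolutely_integrable_1) (auto simp: ell_nonneg)
  moreover have "g \<in> borel_measurable (lebesgue_on {0..1})"
    using assms by (intro continuous_imp_measurable_on_sets_lebesgue) auto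
  moreover have "bounded (g ` {0..1})"
    using assms by (intro compact_imp_bounded compact_continuous_image) auto
  ultimately have "(\<lambda>t. g t * ell q t) absolutely_integrable_on {0..1}"
    by (intro absolutely_integrable_bounded_measurable_product_real) auto
  then show ?thesis
    by (simp add: absolutely_integrable_on_def mult.commute)
qed

text \<open>An involution of \<open>[0, 1]\<close> exchanging the endpoints. All integrals stay in
  \<open>t\<close>, with \<open>u = cay t\<close> as a function of it, in place of a change of
  variables.\<close>

definition cay :: "real \<Rightarrow> real" where
  "cay t = (1 - t) / (1 + t)"

definition kern :: "nat \<Rightarrow> real \<Rightarrow> real" where
  "kern N t = real N * cay t ^ (N - 1) * (2 / (1 + t)\<^sup>2)"

text \<open>In the variable \<open>u = cay t\<close> this is the integral over \<open>[0, 1]\<close> of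
  \<open>N * u ^ (N - 1) * ln ((1 + u) / (1 - u)) ^ q / q!\<close>.\<close>
definition Jint :: "nat \<Rightarrow> nat \<Rightarrow> real" where
  "Jint q N = integral {0..1} (\<lambda>t. ell q t * kern N t)"

lemma cay_power_deriv:
  assumes "-1 < t"
  shows "((\<lambda>t. cay t ^ N) has_real_derivative - kern N t) (at t)"
proof -
  have "(cay has_real_derivative (- 2 / (1 + t)\<^sup>2)) (at t)"
    unfolding cay_def [abs_def] using assms
    by (auto intro!: derivative_eq_intros simp: divide_simps power2_eq_square)
  from DERIV_power[OF this, of N] show ?thesis by (simp add: kern_def ac_simps)
qed

lemma continuous_on_cay: "continuous_on {0..1} cay"
  unfolding cay_def [abs_def] by (intro continuous_intros) auto

lemma continuous_on_kern: "continuous_on {0..1} (kern N)"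
  unfolding kern_def [abs_def] by (intro continuous_intros continuous_on_cay) auto

lemma has_integral_Jint: "((\<lambda>t. ell q t * kern N t) has_integral Jint q N) {0..1}"
  unfolding Jint_def by (intro integrable_integral integrable_ell_times continuous_on_kern)

lemma Jint_q_0: "Jint q 0 = 0"
  by (simp add: Jint_def kern_def)

lemma Jint_0:
  assumes "0 < N"
  shows "Jint 0 N = 1"
proof -
  have "(kern N has_integral (- (cay 1 ^ N) - (- (cay 0 ^ N)))) {0..1}"
  proof (rule fundamental_theorem_of_calculus_interior)
    fix t :: real assume "t \<in> {0<..<1}"
    then show "((\<lambda>t. - (cay t ^ N)) has_vector_derivative kern N t) (at t)"
      using DERIV_minus[OF cay_power_deriv[of t N]]
      by (simp flip: has_real_derivative_iff_has_vector_derivative)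
  qed (auto intro!: continuous_intros continuous_on_cay)
  then show ?thesis
    using assms by (simp add: Jint_def cay_def integral_unique)
qed

text \<open>Integration by parts, with \<open>u = cay t\<close>: \<open>u ^ N - u ^ (N + 2)\<close>
  contains \<open>1 - u^2 = 4 * t / (1 + t)^2\<close>, whose factor \<open>t\<close> cancels the
  \<open>1 / t\<close> from the derivative of \<open>ell\<close> and also tames the singularity at
  0. The rest, \<open>4 / (1 + t)^2 * u ^ N\<close>, is \<open>2 / (N + 1)\<close> times
  \<open>kern (N + 1) t\<close>.\<close>

lemma Jint_rec: "Jint (Suc q) (N + 2) = Jint (Suc q) N + 2 / real (N + 1) * Jint q (N + 1)"
proof -
  define F where "F t = ell (Suc q) t * (cay t ^ N - cay t ^ (N + 2))" for t
  have diff: "cay t ^ N - cay t ^ (N + 2) = t * (cay t ^ N * (4 / (1 + t)\<^sup>2))" if "0 \<le> t" for t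
  proof -
    have "cay t ^ N - cay t ^ (N + 2) = cay t ^ N * (1 - (cay t)\<^sup>2)"
      by (simp add: power_add power2_eq_square algebra_simps)
    also have "1 - (cay t)\<^sup>2 = 4 * t / (1 + t)\<^sup>2"
      using that by (simp add: cay_def power_divide divide_simps) (simp add: power2_eq_square algebra_simps)
    finally show ?thesis by simp
  qed
  have "((\<lambda>t. ell (Suc q) t * kern (N + 2) t - ell (Suc q) t * kern N t
        - 2 / real (N + 1) * (ell q t * kern (N + 1) t)) has_integral (F 1 - F 0)) {0..1}"
  proof (rule fundamental_theorem_of_calculus_interior)
    have "continuous_on {0..1} (\<lambda>t. t * ell (Suc q) t * (cay t ^ N * (4 / (1 + t)\<^sup>2)))"
      by (intro continuous_on_mult[OF continuous_on_times_ell] continuous_intros continuous_on_cay) auto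
    then show "continuous_on {0..1} F"
      by (rule continuous_on_eq) (use diff in \<open>auto simp: F_def\<close>)
    fix t :: real assume t: "t \<in> {0<..<1}"
    have "(F has_real_derivative
        (- ell q t / t * (cay t ^ N - cay t ^ (N + 2)) + (- kern N t - (- kern (N + 2) t)) * ell (Suc q) t)) (at t)"
      using DERIV_mult[OF ell_deriv[of t "Suc q"] DERIV_diff[OF cay_power_deriv[of t N] cay_power_deriv[of t "N + 2"]]] t
      by (simp add: F_def [abs_def])
    also have "- ell q t / t * (cay t ^ N - cay t ^ (N + 2)) + (- kern N t - (- kern (N + 2) t)) * ell (Suc q) t
      = ell (Suc q) t * kern (N + 2) t - ell (Suc q) t * kern N t - 2 / real (N + 1) * (ell q t * kern (N + 1) t)"
    proof -
      have "- ell q t / t * (cay t ^ N - cay t ^ (N + 2)) = - (ell q t * (cay t ^ N * (4 / (1 + t)\<^sup>2)))"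
        using t by (subst diff) auto
      also have "\<dots> = - (2 / real (N + 1) * (ell q t * kern (N + 1) t))"
        by (simp add: kern_def divide_simps)
      finally show ?thesis by (simp add: algebra_simps)
    qed
    finally show "(F has_vector_derivative ell (Suc q) t * kern (N + 2) t - ell (Suc q) t * kern N t
        - 2 / real (N + 1) * (ell q t * kern (N + 1) t)) (at t)"
      by (simp add: has_real_derivative_iff_has_vector_derivative)
  qed simp
  moreover have "F 1 = 0" "F 0 = 0" by (simp_all add: F_def ell_1 cay_def)
  moreover have "((\<lambda>t. ell (Suc q) t * kern (N + 2) t - ell (Suc q) t * kern N t
        - 2 / real (N + 1) * (ell q t * kern (N + 1) t)) has_integral
        (Jint (Suc q) (N + 2) - Jint (Suc q) N - 2 / real (N + 1) * Jint q (N + 1))) {0..1}"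
    by (intro has_integral_diff has_integral_mult_right has_integral_Jint)
  ultimately show ?thesis by (auto dest: has_integral_unique)
qed

text \<open>After \<open>m\<close> terms of the geometric expansion of \<open>1 / (1 + t)\<close>
  the remainder is bounded by \<open>t ^ m * ell q t\<close>, whose integral
  \<open>1 / (m + 1) ^ (q + 1)\<close> tends to 0.\<close>

lemma alternating_series_sums_integral:
  "(\<lambda>n. (-1) ^ n / real (n + 1) ^ Suc q) sums integral {0..1} (\<lambda>t. ell q t * (1 / (1 + t)))"
proof -
  define I where "I = integral {0..1} (\<lambda>t. ell q t * (1 / (1 + t)))"
  have I: "((\<lambda>t. ell q t * (1 / (1 + t))) has_integral I) {0..1}"
    unfolding I_def by (intro integrable_integral integrable_ell_times continuous_intros) auto
  have bound: "\<bar>I - (\<Sum>n<m. (-1) ^ n / real (n + 1) ^ Suc q)\<bar> \<le> 1 / real (m + 1)" for m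
  proof -
    have "((\<lambda>t. \<Sum>n<m. (-1) ^ n * (t ^ n * ell q t)) has_integral (\<Sum>n<m. (-1) ^ n * (1 / real (n + 1) ^ (q + 1)))) {0..1}"
      by (intro has_integral_sum has_integral_mult_right has_integral_power_times_ell) auto
    from has_integral_diff[OF I this]
    have d: "((\<lambda>t. ell q t * (1 / (1 + t)) - (\<Sum>n<m. (-1) ^ n * (t ^ n * ell q t))) has_integral
        (I - (\<Sum>n<m. (-1) ^ n / real (n + 1) ^ Suc q))) {0..1}"
      by simp
    have rem: "ell q t * (1 / (1 + t)) - (\<Sum>n<m. (-1) ^ n * (t ^ n * ell q t)) = (-1) ^ m * (t ^ m * ell q t) / (1 + t)"
      if "t \<in> {0..1}" for t
    proof -
      have "(\<Sum>n<m. (-1) ^ n * (t ^ n * ell q t)) = ell q t * (\<Sum>n<m. (- t) ^ n)"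
        by (simp add: sum_distrib_left power_minus[of t] ac_simps)
      also have "(\<Sum>n<m. (- t) ^ n) = (1 - (- t) ^ m) / (1 + t)"
        using that by (subst sum_gp_strict) auto
      finally show ?thesis
        using that by (simp add: power_minus[of t] field_simps)
    qed
    have "norm (I - (\<Sum>n<m. (-1) ^ n / real (n + 1) ^ Suc q)) \<le> (1 / real (m + 1) ^ (q + 1)) \<bullet> 1"
    proof (rule has_integral_norm_bound_integral_component[OF d has_integral_power_times_ell])
      fix t :: real assume t: "t \<in> {0..1}"
      have "norm ((-1) ^ m * (t ^ m * ell q t) / (1 + t)) = t ^ m * ell q t / (1 + t)"
        using t ell_nonneg[of t q] by (simp add: abs_mult)
      also have "\<dots> \<le> t ^ m * ell q t"
        using t ell_nonneg[of t q] divide_left_mono[of 1 "1 + t" "t ^ m * ell q t"] by simp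
      finally show "norm (ell q t * (1 / (1 + t)) - (\<Sum>n<m. (-1) ^ n * (t ^ n * ell q t))) \<le> (t ^ m * ell q t) \<bullet> 1"
        using rem[OF t] by simp
    qed
    also have "(1 / real (m + 1) ^ (q + 1)) \<bullet> 1 \<le> 1 / real (m + 1)"
      by (simp add: divide_simps)
    finally show ?thesis by simp
  qed
  have "(\<lambda>m. I - (\<Sum>n<m. (-1) ^ n / real (n + 1) ^ Suc q)) \<longlonglongrightarrow> 0"
  proof (rule Lim_null_comparison)
    show "(\<lambda>m. 1 / real (m + 1)) \<longlonglongrightarrow> 0" by real_asymp
  qed (use bound in auto)
  then have "(\<lambda>m. I - (I - (\<Sum>n<m. (-1) ^ n / real (n + 1) ^ Suc q))) \<longlonglongrightarrow> I - 0"
    by (intro tendsto_diff tendsto_const)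
  then show ?thesis by (simp add: sums_def I_def)
qed

lemma Jint_1: "Jint q 1 = 2 * zetabar q"
proof (cases q)
  case 0
  then show ?thesis by (simp add: Jint_0 zetabar_def)
next
  case (Suc q')
  \<comment> \<open>\<open>t * (2 / (1 + t)) = 1 - cay t\<close> is the antiderivative of
    \<open>kern 1\<close> that vanishes at 0, as the singularity of \<open>ell q\<close>
    demands.\<close>
  define F where "F t = t * ell q t * (2 / (1 + t))" for t
  have "((\<lambda>t. ell q t * kern 1 t - 2 * (ell q' t * (1 / (1 + t)))) has_integral (F 1 - F 0)) {0..1}"
  proof (rule fundamental_theorem_of_calculus_interior)
    show "continuous_on {0..1} F"
      unfolding F_def by (intro continuous_on_mult[OF continuous_on_times_ell] continuous_intros) auto
    fix t :: real assume t: "t \<in> {0<..<1}"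
    have "((\<lambda>t. t * (2 / (1 + t))) has_real_derivative (2 / (1 + t)\<^sup>2)) (at t)"
      using t by (auto intro!: derivative_eq_intros simp: divide_simps power2_eq_square)
    from DERIV_mult[OF ell_deriv[of t q] this]
    have "((\<lambda>t. ell q t * (t * (2 / (1 + t)))) has_real_derivative
        (- ell q' t / t * (t * (2 / (1 + t))) + 2 / (1 + t)\<^sup>2 * ell q t)) (at t)"
      using t Suc by simp
    also have "- ell q' t / t * (t * (2 / (1 + t))) + 2 / (1 + t)\<^sup>2 * ell q t
        = ell q t * kern 1 t - 2 * (ell q' t * (1 / (1 + t)))"
      using t by (simp add: kern_def mult.commute)
    finally show "(F has_vector_derivative ell q t * kern 1 t - 2 * (ell q' t * (1 / (1 + t)))) (at t)"
      unfolding has_real_derivative_iff_has_vector_derivative F_def by (simp add: mult.left_commute mult.assoc)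
  qed simp
  moreover have "F 1 = 0" "F 0 = 0" using Suc by (simp_all add: F_def ell_1)
  moreover have "((\<lambda>t. ell q t * kern 1 t - 2 * (ell q' t * (1 / (1 + t)))) has_integral
      (Jint q 1 - 2 * integral {0..1} (\<lambda>t. ell q' t * (1 / (1 + t))))) {0..1}"
    by (intro has_integral_diff has_integral_mult_right has_integral_Jint integrable_integral
        integrable_ell_times continuous_intros) auto
  ultimately have "Jint q 1 = 2 * integral {0..1} (\<lambda>t. ell q' t * (1 / (1 + t)))"
    by (auto dest: has_integral_unique)
  also have "integral {0..1} (\<lambda>t. ell q' t * (1 / (1 + t))) = zetabar q"
    using sums_unique[OF alternating_series_sums_integral[of q']] by (simp add: zetabar_def Suc)
  finally show ?thesis .
qed

section \<open>The duality\<close>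

text \<open>On \<open>[0, 1]\<close> this is the divided power of \<open>2 * arctan (cay t)\<close>.
  Like \<open>ell k\<close> it vanishes at 1 for positive \<open>k\<close>, so only one term of the
  antiderivative \<open>B\<close> survives there.\<close>

definition atn :: "nat \<Rightarrow> real \<Rightarrow> real" where
  "atn k t = (2 * (pi / 4 - arctan t)) ^ k / fact k"

lemma atn_0 [simp]: "atn 0 t = 1"
  by (simp add: atn_def)

lemma atn_1: "atn k 1 = (if k = 0 then 1 else 0)"
  by (simp add: atn_def arctan_one)

lemma atn_deriv:
  "(atn k has_real_derivative (case k of 0 \<Rightarrow> 0 | Suc k' \<Rightarrow> - (2 / (1 + t\<^sup>2)) * atn k' t)) (at t)"
proof (cases k)
  case (Suc k')
  have "((\<lambda>t. 2 * (pi / 4 - arctan t)) has_real_derivative (- (2 / (1 + t\<^sup>2)))) (at t)"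
    by (auto intro!: derivative_eq_intros simp: inverse_eq_divide)
  from DERIV_cdivide[OF DERIV_power[OF this, of "Suc k'"], of "fact (Suc k')"]
  show ?thesis
    using Suc by (simp add: atn_def [abs_def] divide_simps del: power_Suc)
qed (simp add: atn_def [abs_def])

lemma continuous_on_atn: "continuous_on S (atn k)"
  by (meson DERIV_continuous_on atn_deriv has_field_derivative_at_within)

text \<open>In a convolution, lowering the index of one factor amounts to lowering that of the
  other; this is the cancellation behind the telescoping in both indices.\<close>

lemma sum_shift_convolution:
  fixes f g :: "nat \<Rightarrow> real"
  shows "(\<Sum>i\<le>q. (case i of 0 \<Rightarrow> 0 | Suc i' \<Rightarrow> f i') * g (q - i))
       = (\<Sum>i\<le>q. f i * (case q - i of 0 \<Rightarrow> 0 | Suc k \<Rightarrow> g k))"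
proof (cases q)
  case (Suc p)
  have "(\<Sum>i\<le>q. (case i of 0 \<Rightarrow> 0 | Suc i' \<Rightarrow> f i') * g (q - i)) = (\<Sum>i\<le>p. f i * g (p - i))"
    unfolding Suc by (subst sum.atMost_Suc_shift) simp
  also have "\<dots> = (\<Sum>i\<le>p. f i * (case q - i of 0 \<Rightarrow> 0 | Suc k \<Rightarrow> g k))"
    using Suc by (intro sum.cong) (auto simp: Suc_diff_le)
  also have "\<dots> = (\<Sum>i\<le>q. f i * (case q - i of 0 \<Rightarrow> 0 | Suc k \<Rightarrow> g k))"
    using Suc by simp
  finally show ?thesis .
qed simp

text \<open>The sum \<open>B\<close> below is an antiderivative: by the differential equations of the three families,
  its derivative telescopes in both indices.\<close>
lemma has_integral_wgen:
  "((\<lambda>t. ell q t * (2 / (1 + t\<^sup>2) * atn l t)) has_integral wgen (Suc l) q (-1)) {0..1}"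
proof -
  let ?h = "wfun (-1)"
  define B where "B t = (\<Sum>i\<le>q. \<Sum>j\<le>l. ?h (Suc j) i t * ell (q - i) t * atn (l - j) t)" for t
  have "((\<lambda>t. ell q t * (2 / (1 + t\<^sup>2) * atn l t)) has_integral (B 1 - B 0)) {0..1}"
  proof (rule fundamental_theorem_of_calculus_interior)
    have "continuous_on {0..1} (\<lambda>t. wgen r i (- (t\<^sup>2)))" for r i
      by (rule continuous_on_compose2[OF continuous_on_wgen_neg])
         (auto intro!: continuous_intros simp: power_le_one)
    \<comment> \<open>Every depth here is at least 1, so one factor \<open>t\<close> of
      \<open>t ^ Suc j\<close> can be spent on \<open>ell\<close>.\<close>
    then have "continuous_on {0..1} (\<lambda>t. \<Sum>i\<le>q. \<Sum>j\<le>l. (t ^ j * wgen (Suc j) i (- (t\<^sup>2))) * (t * ell (q - i) t) * atn (l - j) t)"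
      by (intro continuous_on_sum continuous_on_mult continuous_on_times_ell continuous_on_atn continuous_on_power continuous_on_id)
    then show "continuous_on {0..1} B"
      by (rule continuous_on_eq) (simp add: B_def wfun_def ac_simps)
    fix t :: real assume t: "t \<in> {0<..<1}"
    define c where "c = 2 / (1 + t\<^sup>2)"
    let ?p = "\<lambda>i j. case i of 0 \<Rightarrow> 0 | Suc i' \<Rightarrow> ?h (Suc j) i' t"
    let ?e = "\<lambda>i. case q - i of 0 \<Rightarrow> 0 | Suc k \<Rightarrow> ell k t"
    let ?a = "\<lambda>j. case l - j of 0 \<Rightarrow> 0 | Suc k \<Rightarrow> atn k t"
    have "((\<lambda>t. ?h (Suc j) i t * ell (q - i) t * atn (l - j) t) has_real_derivative
        ((?p i j / t + c * ?h j i t) * ell (q - i) t + (- ?e i / t) * ?h (Suc j) i t) * atn (l - j) t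
          + (- c * ?a j) * (?h (Suc j) i t * ell (q - i) t)) (at t)" for i j
    proof (intro DERIV_mult)
      show "(?h (Suc j) i has_real_derivative ?p i j / t + c * ?h j i t) (at t)"
        using wfun_deriv[of t "-1" j i] t by (cases i) (simp_all add: c_def)
      show "(ell (q - i) has_real_derivative - ?e i / t) (at t)"
        using ell_deriv[of t "q - i"] t by (cases "q - i") simp_all
      show "(atn (l - j) has_real_derivative - c * ?a j) (at t)"
        using atn_deriv[of "l - j" t] by (cases "l - j") (simp_all add: c_def)
    qed
    then have "(B has_real_derivative (\<Sum>i\<le>q. \<Sum>j\<le>l.
        ((?p i j / t + c * ?h j i t) * ell (q - i) t + (- ?e i / t) * ?h (Suc j) i t) * atn (l - j) t
          + (- c * ?a j) * (?h (Suc j) i t * ell (q - i) t))) (at t)"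
      unfolding B_def [abs_def] by (intro DERIV_sum)
    \<comment> \<open>The terms with \<open>1 / t\<close> shift only \<open>i\<close> and cancel
      completely. Those with \<open>c\<close> shift only \<open>j\<close> and leave the depth 0
      term, which is nonzero only for \<open>i = 0\<close>.\<close>
    also have "(\<Sum>i\<le>q. \<Sum>j\<le>l.
        ((?p i j / t + c * ?h j i t) * ell (q - i) t + (- ?e i / t) * ?h (Suc j) i t) * atn (l - j) t
          + (- c * ?a j) * (?h (Suc j) i t * ell (q - i) t))
      = (\<Sum>i\<le>q. \<Sum>j\<le>l. (?p i j * ell (q - i) t - ?h (Suc j) i t * ?e i) * (atn (l - j) t / t))
        + (\<Sum>i\<le>q. \<Sum>j\<le>l. (?h j i t * atn (l - j) t - ?h (Suc j) i t * ?a j) * (c * ell (q - i) t))"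
      unfolding sum.distrib [symmetric] by (intro sum.cong refl) (simp add: algebra_simps diff_divide_distrib)
    also have "(\<Sum>i\<le>q. \<Sum>j\<le>l. (?p i j * ell (q - i) t - ?h (Suc j) i t * ?e i) * (atn (l - j) t / t)) = 0"
    proof (subst sum.swap, rule sum.neutral, rule ballI)
      fix j
      show "(\<Sum>i\<le>q. (?p i j * ell (q - i) t - ?h (Suc j) i t * ?e i) * (atn (l - j) t / t)) = 0"
        unfolding sum_distrib_right [symmetric] sum_subtractf
        by (subst sum_shift_convolution[of "\<lambda>i. ?h (Suc j) i t" "\<lambda>k. ell k t"]) simp
    qed
    also have "(\<Sum>i\<le>q. \<Sum>j\<le>l. (?h j i t * atn (l - j) t - ?h (Suc j) i t * ?a j) * (c * ell (q - i) t))
        = (\<Sum>i\<le>q. (?h 0 i t * atn l t) * (c * ell (q - i) t))"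
    proof (intro sum.cong refl)
      fix i
      have "(\<Sum>j\<le>l. ?h j i t * atn (l - j) t)
          = (\<Sum>j\<le>l. (if j = 0 then ?h 0 i t * atn l t else 0) + (case j of 0 \<Rightarrow> 0 | Suc j' \<Rightarrow> ?h (Suc j') i t) * atn (l - j) t)"
        by (intro sum.cong) (auto split: nat.split)
      also have "\<dots> = ?h 0 i t * atn l t + (\<Sum>j\<le>l. ?h (Suc j) i t * ?a j)"
        unfolding sum.distrib sum_shift_convolution[of "\<lambda>j. ?h (Suc j) i t" "\<lambda>k. atn k t"] by simp
      finally show "(\<Sum>j\<le>l. (?h j i t * atn (l - j) t - ?h (Suc j) i t * ?a j) * (c * ell (q - i) t))
        = (?h 0 i t * atn l t) * (c * ell (q - i) t)"
        unfolding sum_distrib_right [symmetric] sum_subtractf by simp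
    qed
    also have "\<dots> = (\<Sum>i\<le>q. if i = 0 then ell q t * (c * atn l t) else 0)"
      by (intro sum.cong) (auto simp: wfun_0)
    finally show "(B has_vector_derivative ell q t * (2 / (1 + t\<^sup>2) * atn l t)) (at t)"
      by (simp add: c_def has_real_derivative_iff_has_vector_derivative)
  qed simp
  moreover have "B 1 = wgen (Suc l) q (-1)"
  proof -
    have "B 1 = (\<Sum>i\<le>q. \<Sum>j\<le>l. if i = q \<and> j = l then ?h (Suc j) i 1 else 0)"
      unfolding B_def by (intro sum.cong refl) (auto simp: ell_1 atn_1)
    also have "\<dots> = (\<Sum>i\<le>q. if i = q then ?h (Suc l) i 1 else 0)"
      by (intro sum.cong refl) auto
    also have "\<dots> = ?h (Suc l) q 1" by simp
    finally show ?thesis by (simp add: wfun_def)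
  qed
  moreover have "B 0 = 0" by (simp add: B_def wfun_def)
  ultimately show ?thesis by simp
qed

section \<open>Exchange of series and integral\<close>

lemma arctan_cay:
  assumes "0 \<le> t" "t \<le> 1"
  shows "arctan (cay t) = pi / 4 - arctan t"
proof (cases "t = 1")
  case False
  then have "arctan 1 + arctan (- t) = arctan (cay t)"
    using arctan_add[of 1 "- t"] assms by (simp add: cay_def)
  then show ?thesis by (simp add: arctan_one arctan_minus)
qed (simp add: cay_def arctan_one)

text \<open>Summing over \<open>n\<close> first, each \<open>b j\<close> meets an alternating sum
  starting at \<open>n = j\<close>, which is at most \<open>y j\<close>. So the partial sums
  disappear from the bound; kept in it, for \<open>y n = u ^ (2 * n + l)\<close> with
  \<open>u = cay t\<close>, they would contribute the factor \<open>1 / (1 - u^2)\<close>, of order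
  \<open>1 / t\<close> near 0.\<close>

lemma abs_alternating_times_partial_sums_le:
  fixes b y :: "nat \<Rightarrow> real"
  assumes b: "\<And>j. 0 \<le> b j" and dec: "\<And>n. y (Suc n) \<le> y n" and y: "\<And>n. 0 \<le> y n"
  shows "\<bar>\<Sum>n<M. (-1) ^ n * ((\<Sum>j\<le>n. b j) * y n)\<bar> \<le> (\<Sum>j<M. b j * y j)"
proof -
  have inner: "\<bar>\<Sum>n<M. (if j \<le> n then (-1) ^ n else 0) * y n\<bar> \<le> y j" for j
  proof -
    have "(\<Sum>k<i. if j \<le> k then (-1) ^ k else (0::real))
        = (if i \<le> j \<or> even (i - j) then 0 else (-1) ^ j)" for i
      by (induction i) (auto simp: Suc_diff_le le_Suc_eq not_le minus_one_power_iff)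
    then have "\<bar>\<Sum>k<i. if j \<le> k then (-1) ^ k else (0::real)\<bar> \<le> 1" for i by simp
    \<comment> \<open>Freezing \<open>y\<close> below \<open>j\<close> makes its value at 0 equal to
      \<open>y j\<close>, which is the bound wanted; the terms with \<open>n < j\<close> carry the
      sign 0.\<close>
    moreover have "y (max j (Suc k)) \<le> y (max j k)" for k
      using decseqD[OF decseq_SucI[of y]] dec by simp
    ultimately have "\<bar>\<Sum>n<M. (if j \<le> n then (-1) ^ n else 0) * y (max j n)\<bar> \<le> 1 * y (max j 0)"
      by (intro Abel_inequality) (auto simp: y)
    moreover have "(\<Sum>n<M. (if j \<le> n then (-1) ^ n else 0) * y (max j n)) = (\<Sum>n<M. (if j \<le> n then (-1) ^ n else 0) * y n)"
      by (intro sum.cong) (auto simp: max_def)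
    ultimately show ?thesis by simp
  qed
  have "(\<Sum>n<M. (-1) ^ n * ((\<Sum>j\<le>n. b j) * y n)) = (\<Sum>n<M. \<Sum>j<M. b j * ((if j \<le> n then (-1) ^ n else 0) * y n))"
  proof (intro sum.cong refl)
    fix n assume "n \<in> {..<M}"
    then have "{..<M} \<inter> {j. j \<le> n} = {..n}" by auto
    then have "(\<Sum>j\<le>n. b j) = (\<Sum>j<M. if j \<le> n then b j else 0)"
      by (simp add: sum.If_cases)
    also have "(-1) ^ n * (\<dots> * y n) = (\<Sum>j<M. b j * ((if j \<le> n then (-1) ^ n else 0) * y n))"
      unfolding sum_distrib_left sum_distrib_right by (intro sum.cong) auto
    finally show "(-1) ^ n * ((\<Sum>j\<le>n. b j) * y n) = (\<Sum>j<M. b j * ((if j \<le> n then (-1) ^ n else 0) * y n))" .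
  qed
  also have "\<dots> = (\<Sum>j<M. b j * (\<Sum>n<M. (if j \<le> n then (-1) ^ n else 0) * y n))"
    unfolding sum_distrib_left by (rule sum.swap)
  also have "\<bar>\<dots>\<bar> \<le> (\<Sum>j<M. b j * y j)"
    using inner b by (intro order.trans[OF sum_abs] sum_mono) (auto simp: abs_mult intro!: mult_left_mono)
  finally show ?thesis .
qed

text \<open>The partial sums of the integrand are dominated by the corresponding
  non-alternating series, which is again a power of the logarithm.\<close>
lemma sums_wcoeff_Jint:
  "(\<lambda>n. (-1) ^ n * (wcoeff (Suc l) 0 n * Jint q (2 * n + Suc l))) sums wgen (Suc l) q (-1)"
proof (cases q)
  \<comment> \<open>Separate because \<open>ell 0\<close> does not vanish at \<open>t = 0\<close>,
    where \<open>cay t = 1\<close> lies outside the open disc. Here \<open>Jint 0\<close> is 1 and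
    the claim is the definition of \<open>wgen\<close>.\<close>
  case 0
  have "(\<lambda>n. (-1) ^ n * wcoeff (Suc l) 0 n) sums (\<Sum>n. (-1) ^ n * wcoeff (Suc l) 0 n)"
    by (rule summable_sums[OF summable_alternating_wcoeff])
  then show ?thesis
    using 0 by (simp add: wgen_def Jint_0 mult.commute)
next
  case (Suc q')
  let ?s = "\<lambda>n. \<Sum>j\<le>n. wcoeff l 0 j"
  define f where "f M t = (\<Sum>n<M. (-1) ^ n * (wcoeff (Suc l) 0 n * (ell q t * kern (2 * n + Suc l) t)))" for M t
  \<comment> \<open>The binomial turns \<open>ell (q + l)\<close> into \<open>ell q * ell l\<close>;
    the 4 is the 2 of \<open>wcoeff_Suc\<close> times the 2 of \<open>kern\<close>.\<close>
  define h where "h t = real ((q + l) choose q) * (ell (q + l) t * (4 / (1 + t)\<^sup>2))" for t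
  have f_eq: "f M t = ell q t * (4 / (1 + t)\<^sup>2 * (\<Sum>n<M. (-1) ^ n * (?s n * cay t ^ (2 * n + l))))" for M t
  proof -
    \<comment> \<open>The factor \<open>2 * n + l + 1\<close> of \<open>kern\<close> cancels the
      outer denominator of \<open>wcoeff\<close>, so the depth drops to \<open>l\<close>.\<close>
    have "wcoeff (Suc l) 0 n * kern (2 * n + Suc l) t = 4 / (1 + t)\<^sup>2 * (?s n * cay t ^ (2 * n + l))" for n
    proof -
      have "wcoeff (Suc l) 0 n * kern (2 * n + Suc l) t
          = (real (2 * n + l + 1) * wcoeff (Suc l) 0 n) * (cay t ^ (2 * n + l) * (2 / (1 + t)\<^sup>2))"
        by (simp add: kern_def)
      then show ?thesis
        unfolding wcoeff_Suc by simp
    qed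
    then have "(-1) ^ n * (wcoeff (Suc l) 0 n * (ell q t * kern (2 * n + Suc l) t))
        = ell q t * (4 / (1 + t)\<^sup>2 * ((-1) ^ n * (?s n * cay t ^ (2 * n + l))))" for n
      by (metis (no_types, opaque_lifting) mult.assoc mult.left_commute)
    then show ?thesis by (simp add: f_def sum_distrib_left)
  qed
  have int_f: "(f M has_integral (\<Sum>n<M. (-1) ^ n * (wcoeff (Suc l) 0 n * Jint q (2 * n + Suc l)))) {0..1}" for M
    unfolding f_def by (intro has_integral_sum has_integral_mult_right has_integral_Jint) auto
  have cay: "0 \<le> cay t" "cay t < 1" if "0 < t" "t \<le> 1" for t
    using that by (auto simp: cay_def)
  have "(\<lambda>M. integral {0..1} (f M)) \<longlonglongrightarrow> integral {0..1} (\<lambda>t. ell q t * (2 / (1 + t\<^sup>2) * atn l t))"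
  proof (rule dominated_convergence(2))
    show "f M integrable_on {0..1}" for M
      using int_f by (rule has_integral_integrable)
    show "h integrable_on {0..1}"
      unfolding h_def by (intro integrable_on_mult_right integrable_ell_times continuous_intros) auto
    show "norm (f M t) \<le> h t" if "t \<in> {0..1}" for M t
    proof (cases "t = 0")
      case True
      then show ?thesis by (simp add: f_eq h_def Suc ell_Suc_at_0)
    next
      case False
      then have t: "0 < t" "t \<le> 1" using that by auto
      note c = cay[OF t]
      have "\<bar>\<Sum>n<M. (-1) ^ n * (?s n * cay t ^ (2 * n + l))\<bar> \<le> (\<Sum>n<M. wcoeff l 0 n * cay t ^ (2 * n + l))"
        using c by (intro abs_alternating_times_partial_sums_le wcoeff_nonneg) (auto intro!: power_decreasing simp del: power_Suc)
      also have "\<dots> = cay t ^ l * (\<Sum>n<M. wcoeff l 0 n * (1 * (cay t)\<^sup>2) ^ n)"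
        unfolding sum_distrib_left
        by (intro sum.cong refl) (simp only: power_add power_mult mult_1_left, simp only: ac_simps)
      also have "\<dots> \<le> cay t ^ l * (\<Sum>n. wcoeff l 0 n * (1 * (cay t)\<^sup>2) ^ n)"
        using c by (intro mult_left_mono sum_le_suminf summable_wcoeff_power)
          (auto simp: wcoeff_nonneg power_less_one_iff abs_square_less_1)
      also have "\<dots> = wfun 1 l 0 (cay t)"
        by (simp add: wfun_def wgen_def)
      also have "\<dots> = ell l t"
      proof -
        have "(1 + cay t) / (1 - cay t) = 1 / t"
          using t by (simp add: cay_def divide_simps)
        then show ?thesis
          using c t by (simp add: wfun_ln ell_def ln_div)
      qed
      finally have "\<bar>\<Sum>n<M. (-1) ^ n * (?s n * cay t ^ (2 * n + l))\<bar> \<le> ell l t" .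
      then have "norm (f M t) \<le> ell q t * (4 / (1 + t)\<^sup>2 * ell l t)"
        unfolding f_eq real_norm_def abs_mult using t ell_nonneg[of t q]
        by (intro mult_mono) auto
      also have "\<dots> = h t"
      proof -
        have "real ((q + l) choose q) = fact (q + l) / (fact q * fact l)"
          by (subst binomial_fact) auto
        then show ?thesis
          by (simp add: h_def ell_def power_add ac_simps)
      qed
      finally show ?thesis .
    qed
    show "(\<lambda>M. f M t) \<longlonglongrightarrow> ell q t * (2 / (1 + t\<^sup>2) * atn l t)" if "t \<in> {0..1}" for t
    proof (cases "t = 0")
      case True
      then show ?thesis by (simp add: f_eq Suc ell_Suc_at_0)
    next
      case False
      then have t: "0 < t" "t \<le> 1" using that by auto
      note c = cay[OF t]
      have x: "\<bar>- (cay t)\<^sup>2\<bar> < 1"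
        using c by (simp add: abs_square_less_1)
      have "(\<lambda>n. cay t ^ l * (?s n * (- (cay t)\<^sup>2) ^ n)) sums
          (cay t ^ l * (wgen l 0 (- (cay t)\<^sup>2) / (1 - - (cay t)\<^sup>2)))"
        by (intro sums_mult sums_partial_sums_wcoeff_power x)
      also have "(\<lambda>n. cay t ^ l * (?s n * (- (cay t)\<^sup>2) ^ n)) = (\<lambda>n. (-1) ^ n * (?s n * cay t ^ (2 * n + l)))"
        by (intro ext) (simp add: power_minus[of "(cay t)\<^sup>2"] power_add power_mult)
      also have "cay t ^ l * (wgen l 0 (- (cay t)\<^sup>2) / (1 - - (cay t)\<^sup>2)) = wfun (-1) l 0 (cay t) / (1 + (cay t)\<^sup>2)"
        by (simp add: wfun_def)
      also have "wfun (-1) l 0 (cay t) = atn l t"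
        using c t by (simp add: wfun_arctan arctan_cay atn_def)
      finally have "(\<lambda>M. f M t) \<longlonglongrightarrow> ell q t * (4 / (1 + t)\<^sup>2 * (atn l t / (1 + (cay t)\<^sup>2)))"
        unfolding f_eq sums_def by (intro tendsto_mult tendsto_const)
      also have "4 / (1 + t)\<^sup>2 * (atn l t / (1 + (cay t)\<^sup>2)) = 2 / (1 + t\<^sup>2) * atn l t"
      proof -
        have "(1 + t)\<^sup>2 * (1 + (cay t)\<^sup>2) = (1 + t)\<^sup>2 + (1 - t)\<^sup>2"
          using t by (simp add: cay_def power_divide distrib_left)
        also have "\<dots> = 2 * (1 + t\<^sup>2)"
          by (simp add: power2_eq_square algebra_simps)
        finally have e: "(1 + t)\<^sup>2 * (1 + (cay t)\<^sup>2) = 2 * (1 + t\<^sup>2)" .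
        have "4 * x / (2 * y) = 2 / y * x" for x y :: real by simp
        then show ?thesis unfolding times_divide_times_eq e .
      qed
      finally show ?thesis .
    qed
  qed
  then show ?thesis
    using integral_unique[OF int_f] integral_unique[OF has_integral_wgen[of q l]] by (simp add: sums_def)
qed

section \<open>Harmonic sums\<close>

text \<open>The T- and S-harmonic sums with upper bound \<open>n\<close> are the values of this single function at
  \<open>N = 2 * n\<close> and \<open>N = 2 * n - 1\<close>, T when \<open>l\<close> and \<open>N\<close> differ in parity and S when they agree.\<close>
fun hsum :: "nat \<Rightarrow> nat \<Rightarrow> real" where
  "hsum 0 N = 1"
| "hsum (Suc l) 0 = 0"
| "hsum (Suc l) (Suc 0) = 0"
| "hsum (Suc l) (Suc (Suc N)) = hsum (Suc l) N + 2 / real (N + 1) * hsum l (N + 1)"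

lemma hsum_eq_0: "0 < l \<Longrightarrow> N \<le> l \<Longrightarrow> hsum l N = 0"
proof (induction l N rule: hsum.induct)
  case (4 l N)
  then show ?case by (cases "l = 0") auto
qed auto

lemma hsum_1: "hsum (Suc l) 1 = 0"
  by (simp only: One_nat_def hsum.simps)

text \<open>The partial sums at depth \<open>l\<close> follow the recursion of \<open>hsum\<close>
  along \<open>N = 2 * n + l + 1\<close>; at \<open>n = 0\<close> the start is right because
  \<open>hsum (Suc l) l = 0\<close>. As \<open>N - l\<close> is odd, these are T-sums.\<close>

lemma wcoeff_Suc_eq_hsum: "wcoeff (Suc l) 0 n = 2 / real (2 * n + l + 1) * hsum l (2 * n + l + 1)"
proof -
  have step: "wcoeff (Suc l) 0 n = 2 / real (2 * n + l + 1) * (\<Sum>j\<le>n. wcoeff l 0 j)" for l n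
    using wcoeff_Suc[of n l 0] by (simp add: field_simps del: of_nat_add of_nat_mult of_nat_Suc)
  have sums: "(\<Sum>j\<le>n. wcoeff l 0 j) = hsum l (2 * n + l + 1)" for l n
  proof (induction l arbitrary: n)
    case 0
    show ?case by (induction n) (simp_all add: wcoeff_0)
  next
    case (Suc l)
    show ?case
    proof (induction n)
      case 0
      then show ?case
        using step[of l 0] Suc.IH[of 0] hsum_eq_0[of "Suc l" l] by simp
    next
      case (Suc n)
      then show ?case
        using step[of l "Suc n"] \<open>\<And>n. (\<Sum>j\<le>n. wcoeff l 0 j) = hsum l (2 * n + l + 1)\<close>[of "Suc n"]
        by simp
    qed
  qed
  show "wcoeff (Suc l) 0 n = 2 / real (2 * n + l + 1) * hsum l (2 * n + l + 1)"
    unfolding step sums ..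
qed

text \<open>A step of the common recursion lowers \<open>N\<close> by 2, or \<open>N\<close> and the
  level by 1 each. So the initial value \<open>2 * zetabar (q - i)\<close> at \<open>N = 1\<close>,
  reached after \<open>i\<close> drops of level, enters only for odd \<open>N + i\<close>, and the
  weights of the paths leading to it add up to \<open>hsum i N\<close>. At \<open>q = N = 0\<close>
  the two sides are 0 and 1.\<close>

lemma Jint_eq_hsum:
  assumes "q = 0 \<longrightarrow> 0 < N"
  shows "Jint q N = hsum q N + (\<Sum>i<q. if odd (N + i) then 2 * zetabar (q - i) * hsum i N else 0)"
  using assms
proof (induction q arbitrary: N)
  case 0
  then show ?case by (simp add: Jint_0)
next
  case (Suc q)
  show ?case
  proof (induction N rule: nat_induct2)
    case 0
    have "(\<Sum>i<Suc q. if odd (0 + i) then 2 * zetabar (Suc q - i) * hsum i 0 else 0) = 0"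
    proof (intro sum.neutral ballI)
      show "(if odd (0 + i) then 2 * zetabar (Suc q - i) * hsum i 0 else 0) = 0" for i
        by (cases i) auto
    qed
    then show ?case by (simp add: Jint_q_0 del: sum.lessThan_Suc)
  next
    case 1
    show ?case
      by (subst sum.lessThan_Suc_shift) (auto simp: Jint_1 hsum_1 simp del: One_nat_def intro!: sum.neutral)
  next
    case (step N)
    let ?z = "\<lambda>i. 2 * zetabar (q - i)"
    have J: "Jint q (N + 1) = hsum q (N + 1) + (\<Sum>i<q. if odd (N + 1 + i) then ?z i * hsum i (N + 1) else 0)"
      by (rule Suc.IH) simp
    have h: "hsum (Suc q) (N + 2) = hsum (Suc q) N + 2 / real (N + 1) * hsum q (N + 1)"
      by simp
    have "Jint (Suc q) (N + 2) = hsum (Suc q) (N + 2)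
        + ((\<Sum>i<Suc q. if odd (N + i) then 2 * zetabar (Suc q - i) * hsum i N else 0)
          + 2 / real (N + 1) * (\<Sum>i<q. if odd (N + 1 + i) then ?z i * hsum i (N + 1) else 0))"
      unfolding Jint_rec step.IH J h by (simp only: distrib_left ac_simps)
    also have "(\<Sum>i<Suc q. if odd (N + i) then 2 * zetabar (Suc q - i) * hsum i N else 0)
          + 2 / real (N + 1) * (\<Sum>i<q. if odd (N + 1 + i) then ?z i * hsum i (N + 1) else 0)
        = (if odd N then 2 * zetabar (Suc q) else 0)
          + (\<Sum>i<q. (if odd (N + Suc i) then ?z i * hsum (Suc i) N else 0)
             + 2 / real (N + 1) * (if odd (N + 1 + i) then ?z i * hsum i (N + 1) else 0))"
      unfolding sum.distrib sum_distrib_left [symmetric] by (subst sum.lessThan_Suc_shift) (simp only: diff_Suc_Suc, simp)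
    also have "(\<Sum>i<q. (if odd (N + Suc i) then ?z i * hsum (Suc i) N else 0)
             + 2 / real (N + 1) * (if odd (N + 1 + i) then ?z i * hsum i (N + 1) else 0))
        = (\<Sum>i<q. if odd (N + 2 + Suc i) then ?z i * hsum (Suc i) (N + 2) else 0)"
      by (intro sum.cong refl) (simp add: algebra_simps)
    also have "(if odd N then 2 * zetabar (Suc q) else 0) + \<dots>
        = (\<Sum>i<Suc q. if odd (N + 2 + i) then 2 * zetabar (Suc q - i) * hsum i (N + 2) else 0)"
      by (subst sum.lessThan_Suc_shift) (simp only: diff_Suc_Suc, simp)
    finally show ?case .
  qed
qed

section \<open>Alternating series of products of harmonic sums\<close>

definition Hsum :: "nat \<Rightarrow> nat \<Rightarrow> real" where
  "Hsum r i = (\<Sum>n. (-1) ^ n * (wcoeff r 0 n * hsum i (2 * n + r)))"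

text \<open>Solving \<open>Jint_eq_hsum\<close> for \<open>hsum i\<close> expresses the series
  through the \<open>Jint\<close> series, whose convergence comes from the integrals, and through
  series with smaller \<open>i\<close>.\<close>

lemma sums_Hsum:
  assumes "0 < r"
  shows "(\<lambda>n. (-1) ^ n * (wcoeff r 0 n * hsum i (2 * n + r))) sums Hsum r i"
proof -
  have "summable (\<lambda>n. (-1) ^ n * (wcoeff r 0 n * hsum i (2 * n + r)))"
  proof (induction i rule: less_induct)
    case (less i)
    obtain l where l: "r = Suc l" using assms by (cases r) auto
    have "(-1) ^ n * (wcoeff r 0 n * hsum i (2 * n + r)) = (-1) ^ n * (wcoeff r 0 n * Jint i (2 * n + r))
        - (\<Sum>j<i. (if odd (r + j) then 2 * zetabar (i - j) else 0) * ((-1) ^ n * (wcoeff r 0 n * hsum j (2 * n + r))))" for n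
    proof -
      have "hsum i (2 * n + r) = Jint i (2 * n + r)
          - (\<Sum>j<i. (if odd (r + j) then 2 * zetabar (i - j) else 0) * hsum j (2 * n + r))"
        using assms by (subst Jint_eq_hsum) (auto intro!: sum.cong)
      then show ?thesis
        by (simp only: right_diff_distrib sum_distrib_left) (simp only: ac_simps)
    qed
    moreover have "summable (\<lambda>n. (-1) ^ n * (wcoeff r 0 n * Jint i (2 * n + r)))"
      unfolding l by (rule sums_summable[OF sums_wcoeff_Jint])
    ultimately show ?case
      by (simp only:) (intro summable_diff summable_sum summable_mult less, auto)
  qed
  then show ?thesis unfolding Hsum_def by (rule summable_sums)
qed

lemma wgen_eq_Hsum:
  assumes "0 < r"
  shows "wgen r q (-1) = Hsum r q + (\<Sum>i<q. if odd (r + i) then 2 * zetabar (q - i) * Hsum r i else 0)"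
proof -
  obtain l where l: "r = Suc l" using assms by (cases r) auto
  have "(\<lambda>n. (-1) ^ n * (wcoeff r 0 n * hsum q (2 * n + r))
        + (\<Sum>j<q. (if odd (r + j) then 2 * zetabar (q - j) else 0) * ((-1) ^ n * (wcoeff r 0 n * hsum j (2 * n + r)))))
      sums (Hsum r q + (\<Sum>i<q. (if odd (r + i) then 2 * zetabar (q - i) else 0) * Hsum r i))"
    by (intro sums_add sums_sum sums_mult sums_Hsum assms)
  also have "(\<lambda>n. (-1) ^ n * (wcoeff r 0 n * hsum q (2 * n + r))
        + (\<Sum>j<q. (if odd (r + j) then 2 * zetabar (q - j) else 0) * ((-1) ^ n * (wcoeff r 0 n * hsum j (2 * n + r)))))
      = (\<lambda>n. (-1) ^ n * (wcoeff r 0 n * Jint q (2 * n + r)))"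
  proof
    fix n
    have "Jint q (2 * n + r) = hsum q (2 * n + r)
        + (\<Sum>j<q. (if odd (r + j) then 2 * zetabar (q - j) else 0) * hsum j (2 * n + r))"
      using assms by (subst Jint_eq_hsum) (auto intro!: sum.cong)
    then show "(-1) ^ n * (wcoeff r 0 n * hsum q (2 * n + r))
        + (\<Sum>j<q. (if odd (r + j) then 2 * zetabar (q - j) else 0) * ((-1) ^ n * (wcoeff r 0 n * hsum j (2 * n + r))))
        = (-1) ^ n * (wcoeff r 0 n * Jint q (2 * n + r))"
      by (simp only: distrib_left sum_distrib_left) (simp only: ac_simps)
  qed
  finally have "wgen r q (-1) = Hsum r q + (\<Sum>i<q. (if odd (r + i) then 2 * zetabar (q - i) else 0) * Hsum r i)"
    using sums_wcoeff_Jint[of l q] unfolding l by (rule sums_unique2 [symmetric])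
  also have "(\<Sum>i<q. (if odd (r + i) then 2 * zetabar (q - i) else 0) * Hsum r i)
      = (\<Sum>i<q. if odd (r + i) then 2 * zetabar (q - i) * Hsum r i else 0)"
    by (intro sum.cong) auto
  finally show ?thesis .
qed

text \<open>With \<open>e = 0\<close> and \<open>e = 1\<close> these are the index sets and sums of the T- and S-harmonic sums.\<close>
definition Aidx :: "nat \<Rightarrow> nat \<Rightarrow> nat \<Rightarrow> nat list set" where
  "Aidx e l n = {ns. length ns = l \<and> (0 < l \<longrightarrow> 0 < ns ! 0) \<and>
      (\<forall>i. i + 1 < l \<longrightarrow> (if even (i + e) then ns ! i \<le> ns ! (i+1) else ns ! i < ns ! (i+1))) \<and>
      (0 < l \<longrightarrow> (if even (l - 1 + e) then ns ! (l - 1) \<le> n else ns ! (l - 1) < n))}"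

definition An :: "nat \<Rightarrow> nat \<Rightarrow> nat \<Rightarrow> real" where
  "An e n l = (\<Sum>ns \<in> Aidx e l n. 2 ^ l /
      (\<Prod>i<l. if even (i + e) then 2 * real (ns ! i) - 1 else 2 * real (ns ! i)))"

lemma Tn_eq_An: "Tn n l = An 0 n l"
proof -
  have "Tidx l n = Aidx 0 l n"
    by (cases l) (auto simp: Tidx_def Aidx_def)
  then show ?thesis by (simp add: Tn_def An_def)
qed

lemma Sn_eq_An: "Sn n l = An 1 n l"
proof -
  have "Sidx l n = Aidx 1 l n"
    by (cases l) (auto simp: Sidx_def Aidx_def)
  then show ?thesis
    unfolding Sn_def An_def by (auto intro!: sum.cong prod.cong arg_cong2[of _ _ _ _ "(/)"])
qed

lemma Aidx_Suc:
  "Aidx e (Suc l) n = (\<Union>m\<in>{m. (l = 0 \<longrightarrow> 0 < m) \<and> (if even (l + e) then m \<le> n else m < n)}. (\<lambda>ns. ns @ [m]) ` Aidx e l m)"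
  (is "?L = ?R")
proof
  show "?L \<subseteq> ?R"
  proof
    fix xs assume xs: "xs \<in> ?L"
    then have len: "length xs = Suc l" by (simp add: Aidx_def)
    define ns m where "ns = butlast xs" and "m = last xs"
    have xs_eq: "xs = ns @ [m]"
      using len by (metis append_butlast_last_id list.size(3) m_def nat.distinct(1) ns_def)
    have lns: "length ns = l" using len xs_eq by simp
    have chain: "if even (i + e) then xs ! i \<le> xs ! (i+1) else xs ! i < xs ! (i+1)" if "i < l" for i
      using xs that unfolding Aidx_def by auto
    have xs_nth: "xs ! i = ns ! i" if "i < l" for i
      using that lns by (simp add: xs_eq nth_append)
    have xs_l: "xs ! l = m" by (simp add: xs_eq lns nth_append)
    have "ns \<in> Aidx e l m"
      unfolding Aidx_def mem_Collect_eq
    proof (intro conjI allI impI)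
      show "length ns = l" by (rule lns)
      show "0 < ns ! 0" if "0 < l"
        using xs xs_nth[OF that] by (simp add: Aidx_def)
      show "if even (i + e) then ns ! i \<le> ns ! (i + 1) else ns ! i < ns ! (i + 1)" if "i + 1 < l" for i
        using chain[of i] xs_nth[of i] xs_nth[of "i + 1"] that by (auto split: if_splits)
      show "if even (l - 1 + e) then ns ! (l - 1) \<le> m else ns ! (l - 1) < m" if "0 < l"
        using chain[of "l - 1"] xs_nth[of "l - 1"] xs_l that by (auto split: if_splits)
    qed
    moreover have "(l = 0 \<longrightarrow> 0 < m) \<and> (if even (l + e) then m \<le> n else m < n)"
      using xs xs_l by (auto simp: Aidx_def)
    ultimately show "xs \<in> ?R" using xs_eq by blast
  qed
  show "?R \<subseteq> ?L"
  proof clarify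
    fix m ns assume m: "l = 0 \<longrightarrow> 0 < m" "if even (l + e) then m \<le> n else m < n" and ns: "ns \<in> Aidx e l m"
    have lns: "length ns = l" using ns by (simp add: Aidx_def)
    show "ns @ [m] \<in> ?L"
      unfolding Aidx_def mem_Collect_eq
    proof (intro conjI allI impI)
      show "length (ns @ [m]) = Suc l" using lns by simp
      show "0 < (ns @ [m]) ! 0"
        using ns m lns by (cases "l = 0") (auto simp: Aidx_def nth_append)
      show "if even (i + e) then (ns @ [m]) ! i \<le> (ns @ [m]) ! (i + 1) else (ns @ [m]) ! i < (ns @ [m]) ! (i + 1)"
        if "i + 1 < Suc l" for i
      proof (cases "i + 1 = l")
        case True
        then show ?thesis
          using ns lns by (auto simp: Aidx_def nth_append)
      next
        case False
        then have "i + 1 < l" using that by simp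
        then show ?thesis
          using ns lns by (auto simp: Aidx_def nth_append)
      qed
      show "if even (Suc l - 1 + e) then (ns @ [m]) ! (Suc l - 1) \<le> n else (ns @ [m]) ! (Suc l - 1) < n"
        using m lns by (simp add: nth_append)
    qed
  qed
qed

lemma finite_Aidx: "finite (Aidx e l n)"
proof (induction l arbitrary: n)
  case 0
  have "Aidx e 0 n = {[]}" by (auto simp: Aidx_def)
  then show ?case by simp
next
  case (Suc l)
  have "finite {m. (l = 0 \<longrightarrow> 0 < m) \<and> (if even (l + e) then m \<le> n else m < n)}"
    by (rule finite_subset[of _ "{..n}"]) (auto split: if_splits)
  then show ?case
    unfolding Aidx_Suc by (intro finite_UN_I finite_imageI Suc.IH)
qed

lemma An_0: "An e n 0 = 1"
proof -
  have "Aidx e 0 n = {[]}" by (auto simp: Aidx_def)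
  then show ?thesis by (simp add: An_def)
qed

lemma An_Suc:
  "An e n (Suc l) = (\<Sum>m\<in>{m. (l = 0 \<longrightarrow> 0 < m) \<and> (if even (l + e) then m \<le> n else m < n)}.
     2 / (if even (l + e) then 2 * real m - 1 else 2 * real m) * An e m l)"
proof -
  let ?M = "{m. (l = 0 \<longrightarrow> 0 < m) \<and> (if even (l + e) then m \<le> n else m < n)}"
  let ?w = "\<lambda>i x. if even (i + e) then 2 * real x - 1 else 2 * real x"
  have fin: "finite ?M"
    by (rule finite_subset[of _ "{..n}"]) (auto split: if_splits)
  have "An e n (Suc l) = (\<Sum>m\<in>?M. \<Sum>xs\<in>(\<lambda>ns. ns @ [m]) ` Aidx e l m. 2 ^ Suc l / (\<Prod>i<Suc l. ?w i (xs ! i)))"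
    unfolding An_def Aidx_Suc by (rule sum.UNION_disjoint[OF fin]) (auto simp: finite_Aidx)
  also have "\<dots> = (\<Sum>m\<in>?M. 2 / ?w l m * An e m l)"
  proof (intro sum.cong refl)
    fix m
    have "2 ^ Suc l / (\<Prod>i<Suc l. ?w i ((ns @ [m]) ! i)) = 2 / ?w l m * (2 ^ l / (\<Prod>i<l. ?w i (ns ! i)))"
      if "ns \<in> Aidx e l m" for ns
    proof -
      have lns: "length ns = l" using that by (simp add: Aidx_def)
      have "(\<Prod>i<l. ?w i ((ns @ [m]) ! i)) = (\<Prod>i<l. ?w i (ns ! i))"
        using lns by (intro prod.cong) (auto simp: nth_append)
      then show ?thesis using lns by (simp add: nth_append)
    qed
    then show "(\<Sum>xs\<in>(\<lambda>ns. ns @ [m]) ` Aidx e l m. 2 ^ Suc l / (\<Prod>i<Suc l. ?w i (xs ! i))) = 2 / ?w l m * An e m l"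
      unfolding An_def sum_distrib_left by (subst sum.reindex) (auto simp: inj_on_def intro!: sum.cong)
  qed
  finally show ?thesis .
qed

lemma An_at_0: "0 < l \<Longrightarrow> An e 0 l = 0"
proof (induction l)
  case (Suc l)
  show ?case
    unfolding An_Suc by (rule sum.neutral) (use Suc.IH in \<open>auto split: if_splits\<close>)
qed simp

text \<open>Positivity is imposed on the first index only, so for positive \<open>l\<close> the top
  index \<open>m = 0\<close> formally occurs; no admissible list lies below it, and it contributes
  0.\<close>

lemma An_Suc_pos:
  "An e n (Suc l) = (\<Sum>m\<in>(if even (l + e) then {1..n} else {1..<n}).
     2 / (if even (l + e) then 2 * real m - 1 else 2 * real m) * An e m l)"
  unfolding An_Suc
proof (rule sum.mono_neutral_right)
  show "finite {m. (l = 0 \<longrightarrow> 0 < m) \<and> (if even (l + e) then m \<le> n else m < n)}"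
    by (rule finite_subset[of _ "{..n}"]) (auto split: if_splits)
  show "\<forall>m\<in>{m. (l = 0 \<longrightarrow> 0 < m) \<and> (if even (l + e) then m \<le> n else m < n)} - (if even (l + e) then {1..n} else {1..<n}).
      2 / (if even (l + e) then 2 * real m - 1 else 2 * real m) * An e m l = 0"
  proof
    fix m assume "m \<in> {m. (l = 0 \<longrightarrow> 0 < m) \<and> (if even (l + e) then m \<le> n else m < n)} - (if even (l + e) then {1..n} else {1..<n})"
    then have "m = 0" "0 < l" by (auto split: if_splits)
    then show "2 / (if even (l + e) then 2 * real m - 1 else 2 * real m) * An e m l = 0"
      by (simp add: An_at_0)
  qed
qed (auto split: if_splits)

lemma hsum_even: "hsum (Suc l) (2 * n) = (\<Sum>m=1..n. 2 / (2 * real m - 1) * hsum l (2 * m - 1))"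
  by (induction n) (simp_all add: algebra_simps)

lemma hsum_odd: "hsum (Suc l) (2 * n + 1) = (\<Sum>m=1..<Suc n. 2 / (2 * real m) * hsum l (2 * m))"
proof (induction n)
  case (Suc n)
  have "hsum (Suc l) (2 * Suc n + 1) = hsum (Suc l) (2 * n + 1) + 2 / (2 * real (Suc n)) * hsum l (2 * Suc n)"
    by (simp add: field_simps)
  moreover have "(\<Sum>m=1..<Suc (Suc n). f m) = (\<Sum>m=1..<Suc n. f m) + f (Suc n)" for f :: "nat \<Rightarrow> real"
    by simp
  ultimately show ?case by (simp only: Suc.IH)
qed simp

lemma An_eq_hsum:
  "0 < n \<Longrightarrow> An e n l = hsum l (if even (l + e) then 2 * n - 1 else 2 * n)"
proof (induction l arbitrary: n)
  case 0
  then show ?case by (simp add: An_0)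
next
  case (Suc l)
  show ?case
  proof (cases "even (l + e)")
    case True
    then show ?thesis
      unfolding An_Suc_pos using Suc.IH by (simp add: hsum_even)
  next
    case False
    obtain n' where "n = Suc n'" using Suc.prems by (cases n) auto
    then show ?thesis
      unfolding An_Suc_pos using Suc.IH False hsum_odd[of l n'] by simp
  qed
qed

section \<open>The sums of fixed weight and depth\<close>

lemma finite_increasing_lists:
  "finite {ns. length ns = r \<and> sorted_wrt (<) ns \<and> set ns \<subseteq> {1..N::nat}}"
  by (rule finite_subset[OF _ finite_lists_length_eq[of "{1..N}" r]]) auto

lemma increasing_lists_Suc:
  "{ns. length ns = Suc r \<and> sorted_wrt (<) ns \<and> set ns \<subseteq> {1..Suc N}}
     = {ns. length ns = Suc r \<and> sorted_wrt (<) ns \<and> set ns \<subseteq> {1..N}}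
       \<union> (\<lambda>ns. ns @ [Suc N]) ` {ns. length ns = r \<and> sorted_wrt (<) ns \<and> set ns \<subseteq> {1..N}}" (is "?L = ?A \<union> ?B")
proof
  show "?L \<subseteq> ?A \<union> ?B"
  proof
    fix xs assume "xs \<in> ?L"
    then have xs: "length xs = Suc r" "sorted_wrt (<) xs" "set xs \<subseteq> {1..Suc N}" by auto
    then obtain ns m where eq: "xs = ns @ [m]" by (metis length_Suc_conv_rev)
    have ns: "length ns = r" "sorted_wrt (<) ns" "\<forall>x\<in>set ns. x < m" "set ns \<subseteq> {1..Suc N}" "1 \<le> m" "m \<le> Suc N"
      using xs unfolding eq by (auto simp: sorted_wrt_append)
    show "xs \<in> ?A \<union> ?B"
    proof (cases "m = Suc N")
      case True
      then have "set ns \<subseteq> {1..N}" using ns by force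
      then show ?thesis using ns eq True by blast
    next
      case False
      then have "set xs \<subseteq> {1..N}" using ns eq by force
      then show ?thesis using xs by blast
    qed
  qed
  show "?A \<union> ?B \<subseteq> ?L"
    by (force simp: sorted_wrt_append)
qed

text \<open>Splitting off the largest index leaves a sum without sign, so the recursion involves
  both \<open>g n = (-1) ^ n\<close> and \<open>g n = 1\<close>.\<close>

definition wsum :: "(nat \<Rightarrow> real) \<Rightarrow> nat list \<Rightarrow> nat \<Rightarrow> real" where
  "wsum g ks N = (\<Sum>ns \<in> {ns. length ns = length ks \<and> sorted_wrt (<) ns \<and> set ns \<subseteq> {1..N}}.
        2 ^ length ks * g (last ns) / (\<Prod>i<length ks. (2 * real (ns ! i) - real (i + 1)) ^ (ks ! i)))"

lemma Tbar_partial_eq_wsum: "Tbar_partial ks N = wsum (\<lambda>n. (-1) ^ n) ks N"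
  by (simp add: Tbar_partial_def wsum_def)

text \<open>Since \<open>last []\<close> is unspecified, the empty list is evaluated for a constant
  \<open>g\<close>.\<close>

lemma wsum_Nil: "wsum (\<lambda>_. 1) [] N = 1"
proof -
  have "{ns. length ns = length [] \<and> sorted_wrt (<) ns \<and> set ns \<subseteq> {1..N}} = {[]}" by auto
  then show ?thesis by (simp add: wsum_def)
qed

lemma wsum_snoc_0: "wsum g (ks @ [k]) 0 = 0"
proof -
  have "{ns. length ns = length (ks @ [k]) \<and> sorted_wrt (<) ns \<and> set ns \<subseteq> {1..0::nat}} = {}" by auto
  then show ?thesis unfolding wsum_def by (simp only: sum.empty)
qed

lemma wsum_snoc_Suc:
  "wsum g (ks @ [k]) (Suc N) = wsum g (ks @ [k]) N
     + g (Suc N) * (2 / (2 * real (Suc N) - real (length ks + 1)) ^ k) * wsum (\<lambda>_. 1) ks N"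
proof -
  let ?r = "length ks"
  let ?I = "\<lambda>r N. {ns. length ns = r \<and> sorted_wrt (<) ns \<and> set ns \<subseteq> {1..N}}"
  let ?F = "\<lambda>ns. 2 ^ Suc ?r * g (last ns) / (\<Prod>i<Suc ?r. (2 * real (ns ! i) - real (i + 1)) ^ ((ks @ [k]) ! i))"
  have "wsum g (ks @ [k]) (Suc N) = sum ?F (?I (Suc ?r) N \<union> (\<lambda>ns. ns @ [Suc N]) ` ?I ?r N)"
    unfolding wsum_def increasing_lists_Suc [symmetric] by simp
  also have "\<dots> = sum ?F (?I (Suc ?r) N) + sum ?F ((\<lambda>ns. ns @ [Suc N]) ` ?I ?r N)"
    by (rule sum.union_disjoint) (use finite_increasing_lists in \<open>auto intro!: finite_imageI\<close>)
  also have "sum ?F (?I (Suc ?r) N) = wsum g (ks @ [k]) N"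
    by (simp add: wsum_def)
  also have "sum ?F ((\<lambda>ns. ns @ [Suc N]) ` ?I ?r N)
      = g (Suc N) * (2 / (2 * real (Suc N) - real (length ks + 1)) ^ k) * wsum (\<lambda>_. 1) ks N"
  proof -
    have "?F (ns @ [Suc N]) = g (Suc N) * (2 / (2 * real (Suc N) - real (length ks + 1)) ^ k)
        * (2 ^ ?r * 1 / (\<Prod>i<?r. (2 * real (ns ! i) - real (i + 1)) ^ (ks ! i)))" if "length ns = ?r" for ns
    proof -
      have "(\<Prod>i<?r. (2 * real ((ns @ [Suc N]) ! i) - real (i + 1)) ^ ((ks @ [k]) ! i))
          = (\<Prod>i<?r. (2 * real (ns ! i) - real (i + 1)) ^ (ks ! i))"
        using that by (intro prod.cong) (auto simp: nth_append)
      then show ?thesis using that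
        by (simp only: prod.lessThan_Suc nth_append last_snoc) (simp add: ac_simps)
    qed
    then show ?thesis
      unfolding wsum_def sum_distrib_left
      by (subst sum.reindex) (auto simp: inj_on_def intro!: sum.cong)
  qed
  finally show ?thesis .
qed

lemma wsum_1_eq_0: "N < length ks \<Longrightarrow> wsum (\<lambda>_. 1) ks N = 0"
proof (induction ks arbitrary: N rule: rev_induct)
  case (snoc k ks)
  from snoc.prems show ?case
  proof (induction N)
    case (Suc N)
    then show ?case using snoc.IH[of N] by (simp add: wsum_snoc_Suc)
  qed (simp add: wsum_snoc_0)
qed simp

lemma wsum_snoc_eq_0: "wsum g (ks @ [k]) (length ks) = 0"
proof -
  have "wsum g (ks @ [k]) N = 0" if "N \<le> length ks" for N
    using that
  proof (induction N)
    case (Suc N)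
    then show ?case using wsum_1_eq_0[of N ks] by (simp add: wsum_snoc_Suc)
  qed (simp add: wsum_snoc_0)
  then show ?thesis by simp
qed

text \<open>Write \<open>r\<close> for the new length. The largest index is \<open>j + r\<close>, so
  its denominator \<open>2 * (j + r) - r\<close> is \<open>2 * j + r\<close>, as in
  \<open>tcoeff\<close>; smaller bounds admit no increasing list. Appending to \<open>ks\<close> is
  prefixing to \<open>rev ks\<close>.\<close>

lemma wsum_snoc_eq:
  assumes IH: "\<And>N. wsum (\<lambda>_. 1) ks (N + length ks) = (\<Sum>j\<le>N. tcoeff (rev ks) j)"
  shows "wsum g (ks @ [k]) (N + length (ks @ [k])) = (\<Sum>j\<le>N. g (j + length (ks @ [k])) * tcoeff (rev (ks @ [k])) j)"
proof -
  have step: "wsum g (ks @ [k]) (Suc (N + length ks)) = wsum g (ks @ [k]) (N + length ks)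
      + g (Suc (N + length ks)) * tcoeff (k # rev ks) N" for N
    unfolding wsum_snoc_Suc IH by (simp add: algebra_simps)
  show ?thesis
  proof (induction N)
    case 0
    then show ?case using step[of 0] wsum_snoc_eq_0[of g ks k] by simp
  next
    case (Suc N)
    then show ?case using step[of "Suc N"] by simp
  qed
qed

lemma wsum_1_eq: "wsum (\<lambda>_. 1) ks (N + length ks) = (\<Sum>j\<le>N. tcoeff (rev ks) j)"
proof (induction ks arbitrary: N rule: rev_induct)
  case Nil
  have "(\<Sum>j\<le>N. tcoeff [] j) = (\<Sum>j\<le>N. if j = 0 then 1 else 0)" by (intro sum.cong) auto
  then show ?case by (simp add: wsum_Nil)
next
  case (snoc k ks)
  show ?case using wsum_snoc_eq[OF snoc.IH, of "\<lambda>_. 1" k N] by simp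
qed

lemma Tbar_eq_suminf:
  assumes "ks \<noteq> []" "\<forall>k\<in>set ks. 0 < k"
  shows "Tbar ks = (-1) ^ length ks * (\<Sum>n. (-1) ^ n * tcoeff (rev ks) n)"
proof -
  obtain ls k where ks: "ks = ls @ [k]" using assms(1) by (metis rev_exhaust)
  have "(\<lambda>N. (-1) ^ length ks * (\<Sum>n\<le>N. (-1) ^ n * tcoeff (rev ks) n))
      \<longlonglongrightarrow> (-1) ^ length ks * (\<Sum>n. (-1) ^ n * tcoeff (rev ks) n)"
    by (intro tendsto_mult tendsto_const summable_LIMSEQ' summable_alternating_tcoeff) (use assms in auto)
  moreover have "Tbar_partial ks (N + length ks) = (-1) ^ length ks * (\<Sum>n\<le>N. (-1) ^ n * tcoeff (rev ks) n)" for N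
    unfolding Tbar_partial_eq_wsum ks wsum_snoc_eq[OF wsum_1_eq] sum_distrib_left
    by (intro sum.cong) (auto simp: power_add)
  ultimately have "(\<lambda>N. Tbar_partial ks (N + length ks)) \<longlonglongrightarrow> (-1) ^ length ks * (\<Sum>n. (-1) ^ n * tcoeff (rev ks) n)"
    by simp
  then have "Tbar_partial ks \<longlonglongrightarrow> (-1) ^ length ks * (\<Sum>n. (-1) ^ n * tcoeff (rev ks) n)"
    by (rule LIMSEQ_offset)
  then show ?thesis unfolding Tbar_def by (rule limI)
qed

lemma W_eq_wgen:
  assumes "0 < r"
  shows "W (r + q) r = (-1) ^ r * wgen r q (-1)"
proof -
  have "W (r + q) r = (\<Sum>ks\<in>Iset (r + q) r. (-1) ^ r * (\<Sum>n. (-1) ^ n * tcoeff (rev ks) n))"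
    unfolding W_def using assms by (intro sum.cong refl) (subst Tbar_eq_suminf, auto simp: Iset_def)
  \<comment> \<open>Reversal permutes \<open>Iset\<close>, so the reversed storage disappears after
    summation.\<close>
  also have "\<dots> = (\<Sum>ks\<in>Iset (r + q) r. (-1) ^ r * (\<Sum>n. (-1) ^ n * tcoeff ks n))"
    by (rule sum.reindex_bij_witness[of _ rev rev]) (auto simp: Iset_def)
  also have "\<dots> = (-1) ^ r * (\<Sum>n. \<Sum>ks\<in>Iset (r + q) r. (-1) ^ n * tcoeff ks n)"
    unfolding sum_distrib_left[of "(-1) ^ r", symmetric]
    by (subst suminf_sum) (auto intro!: summable_alternating_tcoeff simp: Iset_def)
  also have "\<dots> = (-1) ^ r * wgen r q (-1)"
    by (simp add: wgen_def wcoeff_def sum_distrib_left mult.commute)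
  finally show ?thesis .
qed

text \<open>The T-sum vanishes for \<open>n + 1 < m\<close>. Dropping these terms and shifting by
  \<open>m - 1\<close> turns the upper bound into \<open>n + m\<close>, so that
  \<open>N = 2 * n + 2 * m\<close>, and the sign into \<open>(-1) ^ (n + m)\<close>.\<close>

lemma sums_T_even_depth:
  assumes "0 < m"
  shows "(\<lambda>n. Tn (n+1) (2*m - 1) * hsum i (2 * (n+1)) / real (n+1) * (-1) ^ (n+1)) sums ((-1) ^ m * Hsum (2*m) i)"
proof -
  let ?f = "\<lambda>n. Tn (n+1) (2*m - 1) * hsum i (2 * (n+1)) / real (n+1) * (-1) ^ (n+1)"
  have T: "Tn (n+1) (2*m - 1) = hsum (2*m - 1) (2 * (n+1))" for n
    using assms unfolding Tn_eq_An by (subst An_eq_hsum) auto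
  have zero: "?f n = 0" if "n < m - 1" for n
    unfolding T using that by (subst hsum_eq_0) auto
  have shift: "?f (n + (m - 1)) = (-1) ^ m * ((-1) ^ n * (wcoeff (2*m) 0 n * hsum i (2 * n + 2*m)))" for n
  proof -
    have "wcoeff (2*m) 0 n = 1 / real (n + m) * hsum (2*m - 1) (2 * n + 2*m)"
      using assms wcoeff_Suc_eq_hsum[of "2*m - 1" n] by (simp add: field_simps)
    moreover have "n + (m - 1) + 1 = n + m" "2 * (n + m) = 2 * n + 2 * m" using assms by auto
    ultimately show ?thesis unfolding T by (simp only: power_add) simp
  qed
  have "(\<lambda>n. ?f (n + (m - 1))) sums ((-1) ^ m * Hsum (2*m) i)"
    unfolding shift by (intro sums_mult sums_Hsum) (use assms in auto)
  then show ?thesis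
    using sums_zero_iff_shift[of "m - 1" ?f] zero by blast
qed

text \<open>At odd depth \<open>wcoeff\<close> has the outer weight \<open>2 / (2 * n - 1)\<close>
  where the series has \<open>1 / (2 * n - 1)\<close>. The resulting factor 1/2 is the origin of the
  constants 4 and 2 in the last two formulas.\<close>

lemma sums_T_odd_depth:
  assumes "0 < m"
  shows "(\<lambda>n. Tn (n+1) (2*m - 2) * hsum i (2 * (n+1) - 1) / (2 * real (n+1) - 1) * (-1) ^ (n+1))
    sums ((-1) ^ m / 2 * Hsum (2*m - 1) i)"
proof -
  let ?f = "\<lambda>n. Tn (n+1) (2*m - 2) * hsum i (2 * (n+1) - 1) / (2 * real (n+1) - 1) * (-1) ^ (n+1)"
  have T: "Tn (n+1) (2*m - 2) = hsum (2*m - 2) (2 * (n+1) - 1)" for n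
    using assms unfolding Tn_eq_An by (subst An_eq_hsum) auto
  have zero: "?f n = 0" if "n < m - 1" for n
    unfolding T using that by (subst hsum_eq_0) auto
  have shift: "?f (n + (m - 1)) = (-1) ^ m / 2 * ((-1) ^ n * (wcoeff (2*m - 1) 0 n * hsum i (2 * n + (2*m - 1))))" for n
  proof -
    have "2 * n + (2*m - 2) + 1 = 2 * n + (2*m - 1)" "Suc (2*m - 2) = 2*m - 1" using assms by auto
    then have "wcoeff (2*m - 1) 0 n = 2 / real (2 * n + (2*m - 1)) * hsum (2*m - 2) (2 * n + (2*m - 1))"
      using wcoeff_Suc_eq_hsum[of "2*m - 2" n] by simp
    moreover have "n + (m - 1) + 1 = n + m" "2 * (n + m) - 1 = 2 * n + (2 * m - 1)"
      "2 * real (n + m) - 1 = real (2 * n + (2 * m - 1))" using assms by auto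
    ultimately show ?thesis unfolding T by (simp only: power_add) simp
  qed
  have "(\<lambda>n. ?f (n + (m - 1))) sums ((-1) ^ m / 2 * Hsum (2*m - 1) i)"
    unfolding shift by (intro sums_mult sums_Hsum) (use assms in auto)
  then show ?thesis
    using sums_zero_iff_shift[of "m - 1" ?f] zero by blast
qed

lemma sum_lessThan_odd_indices:
  fixes f :: "nat \<Rightarrow> real"
  shows "(\<Sum>i<2*k. if odd i then f i else 0) = (\<Sum>j<k. f (2*j + 1))"
    and "(\<Sum>i<2*k+1. if odd i then f i else 0) = (\<Sum>j<k. f (2*j + 1))"
  by (induction k) simp_all

lemma sum_lessThan_even_indices:
  fixes f :: "nat \<Rightarrow> real"
  shows "(\<Sum>i<2*k. if even i then f i else 0) = (\<Sum>j<k. f (2*j))"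
    and "(\<Sum>i<2*k+1. if even i then f i else 0) = (\<Sum>j<Suc k. f (2*j))"
  by (induction k) simp_all

theorem mainTheorem4:
  fixes m p :: nat
  assumes "1 \<le> m" and "1 \<le> p"
  shows
   "W (2*p + 2*m - 1) (2*m) =
      2 * (-1) ^ m * (\<Sum>j = 0..p-1. zetabar (2*p - 2 - 2*j) *
        (\<Sum>n. Tn (n+1) (2*m - 1) * Tn (n+1) (2*j + 1) / real (n+1) * (-1) ^ (n+1))) \<and>
    W (2*p + 2*m - 2) (2*m) =
      2 * (-1) ^ m * (\<Sum>j \<in> {j. j + 2 \<le> p}. zetabar (2*p - 3 - 2*j) *
        (\<Sum>n. Tn (n+1) (2*m - 1) * Tn (n+1) (2*j + 1) / real (n+1) * (-1) ^ (n+1)))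
      + (-1) ^ m * (\<Sum>n. Tn (n+1) (2*m - 1) * Sn (n+1) (2*p - 2) / real (n+1) * (-1) ^ (n+1)) \<and>
    W (2*p + 2*m - 2) (2*m - 1) =
      4 * (-1) ^ (m - 1) * (\<Sum>j = 0..p-1. zetabar (2*p - 1 - 2*j) *
        (\<Sum>n. Tn (n+1) (2*m - 2) * Tn (n+1) (2*j) / (2 * real (n+1) - 1) * (-1) ^ (n+1)))
      + 2 * (-1) ^ (m - 1) * (\<Sum>n. Tn (n+1) (2*m - 2) * Sn (n+1) (2*p - 1) / (2 * real (n+1) - 1) * (-1) ^ (n+1)) \<and>
    W (2*p + 2*m - 3) (2*m - 1) =
      4 * (-1) ^ (m - 1) * (\<Sum>j = 0..p-1. zetabar (2*p - 2 - 2*j) *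
        (\<Sum>n. Tn (n+1) (2*m - 2) * Tn (n+1) (2*j) / (2 * real (n+1) - 1) * (-1) ^ (n+1)))"
proof -
  define P where "P = p - 1"
  have p: "p = Suc P" using assms by (simp add: P_def)
  have m0: "0 < m" using assms by simp
  have sgn_even: "2 * (-1) ^ m * (z * ((-1) ^ m * h)) = 2 * z * h" "(-1) ^ m * ((-1) ^ m * h) = h" for z h :: real
    by (cases "even m"; simp)+
  have sgn_odd: "4 * (-1) ^ (m - 1) * (z * ((-1) ^ m / 2 * h)) = - (2 * z * h)"
    "2 * (-1) ^ (m - 1) * ((-1) ^ m / 2 * h) = - h" for z h :: real
    using m0 by (cases m; cases "even m"; simp)+
  have TT_even: "(\<Sum>n. Tn (n+1) (2*m - 1) * Tn (n+1) (2*j + 1) / real (n+1) * (-1) ^ (n+1)) = (-1) ^ m * Hsum (2*m) (2*j + 1)" for j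
  proof -
    have "Tn (n+1) (2*j + 1) = hsum (2*j + 1) (2 * (n+1))" for n
      unfolding Tn_eq_An by (subst An_eq_hsum) auto
    then show ?thesis using sums_T_even_depth[OF m0, of "2*j + 1"] by (simp only: sums_iff)
  qed
  have TS_even: "(\<Sum>n. Tn (n+1) (2*m - 1) * Sn (n+1) (2*j) / real (n+1) * (-1) ^ (n+1)) = (-1) ^ m * Hsum (2*m) (2*j)" for j
  proof -
    have "Sn (n+1) (2*j) = hsum (2*j) (2 * (n+1))" for n
      unfolding Sn_eq_An by (subst An_eq_hsum) auto
    then show ?thesis using sums_T_even_depth[OF m0, of "2*j"] by (simp only: sums_iff)
  qed
  have TT_odd: "(\<Sum>n. Tn (n+1) (2*m - 2) * Tn (n+1) (2*j) / (2 * real (n+1) - 1) * (-1) ^ (n+1))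
      = (-1) ^ m / 2 * Hsum (2*m - 1) (2*j)" for j
  proof -
    have "Tn (n+1) (2*j) = hsum (2*j) (2 * (n+1) - 1)" for n
      unfolding Tn_eq_An by (subst An_eq_hsum) auto
    then show ?thesis using sums_T_odd_depth[OF m0, of "2*j"] by (simp only: sums_iff)
  qed
  have TS_odd: "(\<Sum>n. Tn (n+1) (2*m - 2) * Sn (n+1) (2*j + 1) / (2 * real (n+1) - 1) * (-1) ^ (n+1))
      = (-1) ^ m / 2 * Hsum (2*m - 1) (2*j + 1)" for j
  proof -
    have "Sn (n+1) (2*j + 1) = hsum (2*j + 1) (2 * (n+1) - 1)" for n
      unfolding Sn_eq_An by (subst An_eq_hsum) auto
    then show ?thesis using sums_T_odd_depth[OF m0, of "2*j + 1"] by (simp only: sums_iff)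
  qed
  have W_even: "W (2*m + q) (2*m) = Hsum (2*m) q + (\<Sum>i<q. if odd i then 2 * zetabar (q - i) * Hsum (2*m) i else 0)" for q
    using m0 by (simp add: W_eq_wgen wgen_eq_Hsum)
  have W_odd: "W (2*m - 1 + q) (2*m - 1)
      = - (Hsum (2*m - 1) q + (\<Sum>i<q. if even i then 2 * zetabar (q - i) * Hsum (2*m - 1) i else 0))" for q
  proof -
    have o: "odd (2*m - 1)" using m0 by simp
    then have "(-1::real) ^ (2*m - 1) = - 1" "\<And>i. odd (2*m - 1 + i) \<longleftrightarrow> even i"
      by (simp_all add: minus_one_power_iff)
    moreover have "0 < 2*m - 1" using m0 by simp
    ultimately show ?thesis by (simp only: W_eq_wgen wgen_eq_Hsum mult_minus1)
  qed
  \<comment> \<open>Lets \<open>Hsum r q\<close> join the sum as its last term in the first and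
    fourth formulas.\<close>
  have z0: "2 * zetabar 0 = 1" by (simp add: zetabar_def)
  have idx: "2*p + 2*m - 1 = 2*m + (2*P + 1)" "2*p + 2*m - 2 = 2*m + 2*P" "2*p + 2*m - 3 = 2*m - 1 + 2*P"
    "2*p - 2 = 2*P" "2*p - 1 = 2*P + 1" "p - 1 = P" "{j. j + 2 \<le> p} = {..<P}" "{0..P} = {..<Suc P}"
    using p m0 by auto
  have idx': "2*p - 3 - 2*j = 2*P - (2*j + 1)" for j
    using p by auto
  \<comment> \<open>The same weight is read with depth \<open>2 * m\<close> and with depth
    \<open>2 * m - 1\<close>, where the excess is larger by 1.\<close>
  have idx'': "2*m + 2*P = 2*m - 1 + (2*P + 1)"
    using m0 by auto
  have "W (2*m + (2*P + 1)) (2*m) = (\<Sum>j<Suc P. 2 * zetabar (2*P - 2*j) * Hsum (2*m) (2*j + 1))"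
    unfolding W_even sum_lessThan_odd_indices(2) by (simp add: z0)
  moreover have "W (2*m + 2*P) (2*m) = (\<Sum>j<P. 2 * zetabar (2*P - (2*j + 1)) * Hsum (2*m) (2*j + 1)) + Hsum (2*m) (2*P)"
    unfolding W_even sum_lessThan_odd_indices(1) by simp
  moreover have "W (2*m + 2*P) (2*m - 1)
      = (\<Sum>j<Suc P. - (2 * zetabar (2*P + 1 - 2*j) * Hsum (2*m - 1) (2*j))) + - Hsum (2*m - 1) (2*P + 1)"
    unfolding idx'' W_odd sum_lessThan_even_indices(2) sum_negf by simp
  moreover have "W (2*m - 1 + 2*P) (2*m - 1) = (\<Sum>j<Suc P. - (2 * zetabar (2*P - 2*j) * Hsum (2*m - 1) (2*j)))"
    unfolding W_odd sum_lessThan_even_indices(1) sum_negf by (simp add: z0)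
  ultimately show ?thesis
    unfolding idx idx' TT_even TS_even TT_odd TS_odd sum_distrib_left sgn_even sgn_odd by blast
qed

end
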